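(* Let $\rho\in\mathcal P^\infty_+(M)$ and let $[f]$ be a regular covector, $f\in C^\infty(M)$. Then the following statements hold. (i) The Otto and Stein density tangents agree, $K^W_\rho f=K^S_\rho f$, if and only if $M_\rho\operatorname{grad}f=\operatorname{grad}f$. (ii) The selected particle fields $-\operatorname{grad}f$ (Otto) and $-S_\rho\operatorname{grad}f$ (Stein) agree in $L^2(\rho;TM)$ if and only if $S_\rho\operatorname{grad}f=\operatorname{grad}f$. (iii) Equality of the density tangents implies that the difference $S_\rho\operatorname{grad}f-\operatorname{grad}f$ is vertical, namely it belongs to $\ker A_\rho$. (iv) The tangent defect satisfies the exact identity $$\|K^S_\rho f-K^W_\rho f\|_{\dot H^{-1}_\rho}=\|(M_\rho-\mathrm{id})\operatorname{grad}f\|_{L^2(\rho)}.$$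
   Context: $M$ is a connected, closed, oriented Riemannian manifold with metric $g$ and volume $\mathrm{vol}$; $\mathcal P^\infty_+(M)$ is the set of smooth strictly positive $\rho$ with $\int_M\rho\,d\mathrm{vol}=1$. A regular covector is a smooth function modulo constants. $\mathcal H_k$ is the reproducing kernel Hilbert space of vector fields of a smooth positive definite kernel $k(x,y):T_xM\to T_yM$, assumed continuously included in $C^1(M;TM)$; $I_\rho:\mathcal H_k\to L^2(\rho;TM)$ is the inclusion (the target has inner product $\int_M\langle u,v\rangle_g\rho\,d\mathrm{vol}$) and $I_\rho^*$ its adjoint. $A_\rho v=-\operatorname{div}(\rho v)$ in distributions, on $L^2(\rho;TM)$. $K^W_\rho f=-\operatorname{div}(\rho\operatorname{grad}f)$ and $K^S_\rho f=-\operatorname{div}(\rho I_\rho^*\operatorname{grad}f)$. $H^W_\rho$ is the $L^2(\rho;TM)$-closure of $\{\operatorname{grad}h:h\in C^\infty(M)\}$, $P^{\mathrm{hor}}_\rho$ the orthogonal projection of $L^2(\rho;TM)$ onto it, $S_\rho=I_\rho I_\rho^*$ on $L^2(\rho;TM)$ and $M_\rho=P^{\mathrm{hor}}_\rho S_\rho|_{H^W_\rho}$. $\dot H^{-1}_\rho$ is the Hilbert dual of $H^1(M)/\mathbf R$ with inner product $\int_M\rho\langle\operatorname{grad}f,\operatorname{grad}h\rangle_g\,d\mathrm{vol}$. *)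

theory Defs
  imports "HOL-Analysis.Analysis" "HOL-Library.Function_Algebras"
begin

section \<open>Smoothness in Euclidean space\<close>

text \<open>\<open>Ck_on k U f\<close> is the class \<open>C\<^sup>k\<close> on \<open>U\<close>; it is only used for open \<open>U\<close>.\<close>

primrec Ck_on :: "nat \<Rightarrow> 'e::real_normed_vector set \<Rightarrow> ('e \<Rightarrow> 'f::real_normed_vector) \<Rightarrow> bool" where
  "Ck_on 0 U f \<longleftrightarrow> continuous_on U f"
| "Ck_on (Suc k) U f \<longleftrightarrow>
     (\<forall>x\<in>U. f differentiable (at x)) \<and>
     (\<forall>v. Ck_on k U (\<lambda>x. frechet_derivative f (at x) v))"

definition smooth_on :: "'e::real_normed_vector set \<Rightarrow> ('e \<Rightarrow> 'f::real_normed_vector) \<Rightarrow> bool" where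
  "smooth_on U f \<longleftrightarrow> (\<forall>k. Ck_on k U f)"


section \<open>Closed oriented Riemannian manifolds\<close>

text \<open>The points of the manifold are the elements of a topological space \<open>'a\<close>. A chart is a pair
  of its domain and its coordinate map; the values of the map outside the domain are irrelevant.

  A tangent vector at \<open>p\<close> is the family of its coordinate vectors, one for each chart around \<open>p\<close>,
  which transform by the derivatives of the transition maps. The family is set to zero at
  all other pairs, so that tangent vectors are determined by their meaningful components.
  The vector space operations on tangent vectors, and those on vector fields, are pointwise;
  addition and subtraction are the pointwise operations on function types.\<close>

type_synonym ('a, 'n) chart = "'a set \<times> ('a \<Rightarrow> real ^ 'n)"
type_synonym ('a, 'n) tangent = "('a, 'n) chart \<Rightarrow> real ^ 'n"
type_synonym ('a, 'n) vfield = "'a \<Rightarrow> ('a, 'n) tangent"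

record ('a, 'n) riem =
  atlas :: "('a, 'n) chart set"
  gmet :: "'a \<Rightarrow> ('a, 'n) tangent \<Rightarrow> ('a, 'n) tangent \<Rightarrow> real"
  dvol :: "'a measure"

definition chart_image :: "('a, 'n) chart \<Rightarrow> (real ^ 'n) set" where
  "chart_image c = snd c ` fst c"

definition chart_inv :: "('a, 'n) chart \<Rightarrow> real ^ 'n \<Rightarrow> 'a" where
  "chart_inv c = inv_into (fst c) (snd c)"

definition charts_at :: "('a, 'n, 'z) riem_scheme \<Rightarrow> 'a \<Rightarrow> ('a, 'n) chart set" where
  "charts_at M p = {c \<in> atlas M. p \<in> fst c}"

definition transition :: "('a, 'n) chart \<Rightarrow> ('a, 'n) chart \<Rightarrow> real ^ 'n \<Rightarrow> real ^ 'n" where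
  "transition c d = snd d \<circ> chart_inv c"

definition transition_deriv ::
  "('a, 'n::finite) chart \<Rightarrow> ('a, 'n) chart \<Rightarrow> 'a \<Rightarrow> real ^ 'n \<Rightarrow> real ^ 'n" where
  "transition_deriv c d p = frechet_derivative (transition c d) (at (snd c p))"

text \<open>A smooth atlas all of whose transition maps preserve the orientation of Euclidean space;
  it encodes both the smooth structure and the orientation.\<close>

definition oriented_smooth_atlas :: "('a::topological_space, 'n::finite) chart set \<Rightarrow> bool" where
  "oriented_smooth_atlas A \<longleftrightarrow>
     (\<Union>c\<in>A. fst c) = UNIV \<and>
     (\<forall>c\<in>A. open (fst c) \<and> open (chart_image c) \<and>
        homeomorphism (fst c) (chart_image c) (snd c) (chart_inv c)) \<and>
     (\<forall>c\<in>A. \<forall>d\<in>A.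
        smooth_on (snd c ` (fst c \<inter> fst d)) (transition c d) \<and>
        (\<forall>p\<in>fst c \<inter> fst d. det (matrix (transition_deriv c d p)) > 0))"

definition tangent_space :: "('a, 'n::finite, 'z) riem_scheme \<Rightarrow> 'a \<Rightarrow> ('a, 'n) tangent set" where
  "tangent_space M p = {\<xi>.
     (\<forall>c\<in>charts_at M p. \<forall>d\<in>charts_at M p. \<xi> d = transition_deriv c d p (\<xi> c)) \<and>
     (\<forall>c. c \<notin> charts_at M p \<longrightarrow> \<xi> c = 0)}"

text \<open>The tangent vector at \<open>p\<close> with coordinates \<open>a\<close> in the chart \<open>c\<close>, in particular the
  \<open>i\<close>-th coordinate vector of \<open>c\<close> at \<open>p\<close>.\<close>

definition tangent_of ::
  "('a, 'n::finite, 'z) riem_scheme \<Rightarrow> ('a, 'n) chart \<Rightarrow> 'a \<Rightarrow> real ^ 'n \<Rightarrow> ('a, 'n) tangent" where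
  "tangent_of M c p a = (\<lambda>d. if d \<in> charts_at M p then transition_deriv c d p a else 0)"

definition coord_vec ::
  "('a, 'n::finite, 'z) riem_scheme \<Rightarrow> ('a, 'n) chart \<Rightarrow> 'a \<Rightarrow> 'n \<Rightarrow> ('a, 'n) tangent" where
  "coord_vec M c p i = tangent_of M c p (axis i 1)"

definition tscale :: "real \<Rightarrow> ('a, 'n::finite) tangent \<Rightarrow> ('a, 'n) tangent" where
  "tscale r \<xi> = (\<lambda>c. r *\<^sub>R \<xi> c)"

definition fscale :: "('a \<Rightarrow> real) \<Rightarrow> ('a, 'n::finite) vfield \<Rightarrow> ('a, 'n) vfield" where
  "fscale \<phi> v = (\<lambda>p. tscale (\<phi> p) (v p))"

definition gram :: "('a, 'n::finite, 'z) riem_scheme \<Rightarrow> ('a, 'n) chart \<Rightarrow> 'a \<Rightarrow> real ^ 'n ^ 'n" where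
  "gram M c p = (\<chi> i j. gmet M p (coord_vec M c p i) (coord_vec M c p j))"

definition riemannian_metric :: "('a, 'n::finite, 'z) riem_scheme \<Rightarrow> bool" where
  "riemannian_metric M \<longleftrightarrow>
     (\<forall>p. \<forall>\<xi>\<in>tangent_space M p. \<forall>\<eta>\<in>tangent_space M p. \<forall>\<zeta>\<in>tangent_space M p. \<forall>r.
        gmet M p \<xi> \<eta> = gmet M p \<eta> \<xi> \<and>
        gmet M p (\<xi> + \<zeta>) \<eta> = gmet M p \<xi> \<eta> + gmet M p \<zeta> \<eta> \<and>
        gmet M p (tscale r \<xi>) \<eta> = r * gmet M p \<xi> \<eta> \<and>
        (\<xi> \<noteq> 0 \<longrightarrow> gmet M p \<xi> \<xi> > 0)) \<and>
     (\<forall>c\<in>atlas M. \<forall>i j. smooth_on (chart_image c) (\<lambda>x. gram M c (chart_inv c x) $ i $ j))"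

text \<open>The Riemannian volume measure is the unique Borel measure that in each chart is
  given by the density \<open>sqrt (det (g\<^sub>i\<^sub>j))\<close>.\<close>

definition riemannian_volume :: "('a::topological_space, 'n::finite, 'z) riem_scheme \<Rightarrow> bool" where
  "riemannian_volume M \<longleftrightarrow>
     sets (dvol M) = sets borel \<and>
     (\<forall>c\<in>atlas M. \<forall>B\<in>sets borel. B \<subseteq> fst c \<longrightarrow>
        emeasure (dvol M) B =
        (\<integral>\<^sup>+x. ennreal (sqrt (det (gram M c (chart_inv c x)))) * indicator (snd c ` B) x \<partial>lborel))"

definition closed_oriented_riemannian ::
  "('a::{t2_space, second_countable_topology}, 'n::finite, 'z) riem_scheme \<Rightarrow> bool" where
  "closed_oriented_riemannian M \<longleftrightarrow>
     compact (UNIV :: 'a set) \<and> connected (UNIV :: 'a set) \<and>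
     oriented_smooth_atlas (atlas M) \<and> riemannian_metric M \<and> riemannian_volume M"


section \<open>Smooth functions, gradients, densities\<close>

definition smooth_fun :: "('a, 'n::finite, 'z) riem_scheme \<Rightarrow> ('a \<Rightarrow> real) \<Rightarrow> bool" where
  "smooth_fun M f \<longleftrightarrow> (\<forall>c\<in>atlas M. smooth_on (chart_image c) (f \<circ> chart_inv c))"

text \<open>The differential is independent of the chart that is chosen to compute it.\<close>

definition differential ::
  "('a, 'n::finite, 'z) riem_scheme \<Rightarrow> ('a \<Rightarrow> real) \<Rightarrow> 'a \<Rightarrow> ('a, 'n) tangent \<Rightarrow> real" where
  "differential M f p \<xi> =
     (let c = (SOME c. c \<in> charts_at M p)
      in frechet_derivative (f \<circ> chart_inv c) (at (snd c p)) (\<xi> c))"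

definition grad :: "('a, 'n::finite, 'z) riem_scheme \<Rightarrow> ('a \<Rightarrow> real) \<Rightarrow> ('a, 'n) vfield" where
  "grad M f = (\<lambda>p. THE \<xi>. \<xi> \<in> tangent_space M p \<and>
     (\<forall>\<eta>\<in>tangent_space M p. gmet M p \<xi> \<eta> = differential M f p \<eta>))"

definition smooth_pos_density :: "('a, 'n::finite, 'z) riem_scheme \<Rightarrow> ('a \<Rightarrow> real) \<Rightarrow> bool" where
  "smooth_pos_density M \<rho> \<longleftrightarrow>
     smooth_fun M \<rho> \<and> (\<forall>p. \<rho> p > 0) \<and> (\<integral>p. \<rho> p \<partial>dvol M) = 1"

definition vector_fields :: "('a, 'n::finite, 'z) riem_scheme \<Rightarrow> ('a, 'n) vfield set" where
  "vector_fields M = {v. \<forall>p. v p \<in> tangent_space M p}"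

definition C1_vector_fields :: "('a, 'n::finite, 'z) riem_scheme \<Rightarrow> ('a, 'n) vfield set" where
  "C1_vector_fields M =
     {v \<in> vector_fields M. \<forall>c\<in>atlas M. Ck_on 1 (chart_image c) (\<lambda>x. v (chart_inv c x) c)}"


section \<open>Square integrable vector fields\<close>

text \<open>Elements of \<open>L\<^sup>2(\<rho>; TM)\<close> are represented by measurable vector fields; equality in
  \<open>L\<^sup>2(\<rho>; TM)\<close> is equality almost everywhere. As \<open>\<rho> > 0\<close>, the null sets of \<open>\<rho> dvol\<close> are
  those of \<open>dvol\<close>. By the convention on tangent vectors, the components of a vector field in a
  chart vanish outside of the domain of that chart, so their Borel measurability on the
  whole space is Borel measurability on the domain.\<close>

definition L2_vf ::
  "('a::topological_space, 'n::finite, 'z) riem_scheme \<Rightarrow> ('a \<Rightarrow> real) \<Rightarrow> ('a, 'n) vfield set" where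
  "L2_vf M \<rho> = {v \<in> vector_fields M.
     (\<forall>c\<in>atlas M. (\<lambda>p. v p c) \<in> borel_measurable borel) \<and>
     integrable (dvol M) (\<lambda>p. gmet M p (v p) (v p) * \<rho> p)}"

definition L2_inner ::
  "('a, 'n::finite, 'z) riem_scheme \<Rightarrow> ('a \<Rightarrow> real) \<Rightarrow> ('a, 'n) vfield \<Rightarrow> ('a, 'n) vfield \<Rightarrow> real" where
  "L2_inner M \<rho> u v = (\<integral>p. gmet M p (u p) (v p) * \<rho> p \<partial>dvol M)"

definition L2_norm ::
  "('a, 'n::finite, 'z) riem_scheme \<Rightarrow> ('a \<Rightarrow> real) \<Rightarrow> ('a, 'n) vfield \<Rightarrow> real" where
  "L2_norm M \<rho> v = sqrt (L2_inner M \<rho> v v)"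

definition L2_eq ::
  "('a, 'n::finite, 'z) riem_scheme \<Rightarrow> ('a, 'n) vfield \<Rightarrow> ('a, 'n) vfield \<Rightarrow> bool" where
  "L2_eq M u v \<longleftrightarrow> (AE p in dvol M. u p = v p)"

definition horizontal ::
  "('a::topological_space, 'n::finite, 'z) riem_scheme \<Rightarrow> ('a \<Rightarrow> real) \<Rightarrow> ('a, 'n) vfield set" where
  "horizontal M \<rho> = {v \<in> L2_vf M \<rho>.
     \<forall>\<epsilon>>0. \<exists>h. smooth_fun M h \<and> L2_norm M \<rho> (v - grad M h) < \<epsilon>}"

text \<open>The projection is unique almost everywhere; a representative is chosen.\<close>

definition hor_proj ::
  "('a::topological_space, 'n::finite, 'z) riem_scheme \<Rightarrow> ('a \<Rightarrow> real) \<Rightarrow>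
    ('a, 'n) vfield \<Rightarrow> ('a, 'n) vfield" where
  "hor_proj M \<rho> v = (SOME w. w \<in> horizontal M \<rho> \<and>
     (\<forall>u\<in>horizontal M \<rho>. L2_inner M \<rho> (v - w) u = 0))"


section \<open>Kernels and their reproducing kernel Hilbert spaces\<close>

type_synonym ('a, 'n) vkernel = "'a \<Rightarrow> 'a \<Rightarrow> ('a, 'n) tangent \<Rightarrow> ('a, 'n) tangent"

definition smooth_pd_kernel :: "('a, 'n::finite, 'z) riem_scheme \<Rightarrow> ('a, 'n) vkernel \<Rightarrow> bool" where
  "smooth_pd_kernel M k \<longleftrightarrow>
     (\<forall>x y. \<forall>\<xi>\<in>tangent_space M x. \<forall>\<zeta>\<in>tangent_space M x. \<forall>r.
        k x y \<xi> \<in> tangent_space M y \<and>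
        k x y (\<xi> + \<zeta>) = k x y \<xi> + k x y \<zeta> \<and>
        k x y (tscale r \<xi>) = tscale r (k x y \<xi>)) \<and>
     (\<forall>c\<in>atlas M. \<forall>d\<in>atlas M. \<forall>i.
        smooth_on (chart_image c \<times> chart_image d)
          (\<lambda>(s, t). k (chart_inv c s) (chart_inv d t) (coord_vec M c (chart_inv c s) i) d)) \<and>
     (\<forall>x y. \<forall>\<xi>\<in>tangent_space M x. \<forall>\<eta>\<in>tangent_space M y.
        gmet M y (k x y \<xi>) \<eta> = gmet M x \<xi> (k y x \<eta>)) \<and>
     (\<forall>(N::nat) x \<xi>. (\<forall>i<N. \<xi> i \<in> tangent_space M (x i)) \<longrightarrow>
        (\<Sum>i<N. \<Sum>j<N. gmet M (x j) (k (x i) (x j) (\<xi> i)) (\<xi> j)) \<ge> 0)"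

definition Hnorm :: "(('a, 'n) vfield \<Rightarrow> ('a, 'n) vfield \<Rightarrow> real) \<Rightarrow> ('a, 'n) vfield \<Rightarrow> real" where
  "Hnorm ip v = sqrt (ip v v)"

text \<open>\<open>rkhs M k H ip\<close>: the space \<open>H\<close> of (everywhere defined) vector fields with the inner product
  \<open>ip\<close> is a Hilbert space with reproducing kernel \<open>k\<close>. For a given \<open>k\<close> these
  conditions determine \<open>H\<close>, and \<open>ip\<close> on \<open>H\<close>.\<close>

definition rkhs ::
  "('a, 'n::finite, 'z) riem_scheme \<Rightarrow> ('a, 'n) vkernel \<Rightarrow> ('a, 'n) vfield set \<Rightarrow>
    (('a, 'n) vfield \<Rightarrow> ('a, 'n) vfield \<Rightarrow> real) \<Rightarrow> bool" where
  "rkhs M k H ip \<longleftrightarrow>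
     H \<subseteq> vector_fields M \<and> 0 \<in> H \<and>
     (\<forall>u\<in>H. \<forall>v\<in>H. u + v \<in> H) \<and> (\<forall>r. \<forall>v\<in>H. fscale (\<lambda>_. r) v \<in> H) \<and>
     (\<forall>u\<in>H. \<forall>v\<in>H. \<forall>w\<in>H. \<forall>r.
        ip u v = ip v u \<and> ip (u + w) v = ip u v + ip w v \<and>
        ip (fscale (\<lambda>_. r) u) v = r * ip u v \<and> (u \<noteq> 0 \<longrightarrow> ip u u > 0)) \<and>
     (\<forall>s. (\<forall>n::nat. s n \<in> H) \<and> (\<forall>\<epsilon>>0. \<exists>N. \<forall>m\<ge>N. \<forall>n\<ge>N. Hnorm ip (s m - s n) < \<epsilon>) \<longrightarrow>
        (\<exists>v\<in>H. (\<lambda>n. Hnorm ip (s n - v)) \<longlonglongrightarrow> 0)) \<and>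
     (\<forall>x. \<forall>\<xi>\<in>tangent_space M x.
        (\<lambda>y. k x y \<xi>) \<in> H \<and> (\<forall>v\<in>H. ip (\<lambda>y. k x y \<xi>) v = gmet M x \<xi> (v x)))"

text \<open>The topology of \<open>C\<^sup>1(M; TM)\<close> is given by the seminorms that take, on a compact
  subset of a chart domain, the suprema of the components and of their first partial
  derivatives.\<close>

definition continuously_in_C1 ::
  "('a::topological_space, 'n::finite, 'z) riem_scheme \<Rightarrow> ('a, 'n) vfield set \<Rightarrow>
    (('a, 'n) vfield \<Rightarrow> ('a, 'n) vfield \<Rightarrow> real) \<Rightarrow> bool" where
  "continuously_in_C1 M H ip \<longleftrightarrow>
     H \<subseteq> C1_vector_fields M \<and>
     (\<forall>c\<in>atlas M. \<forall>K. compact K \<and> K \<subseteq> fst c \<longrightarrow>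
        (\<exists>C. \<forall>v\<in>H. \<forall>p\<in>K.
           norm (v p c) \<le> C * Hnorm ip v \<and>
           (\<forall>i. norm (frechet_derivative (\<lambda>x. v (chart_inv c x) c) (at (snd c p)) (axis i 1))
                  \<le> C * Hnorm ip v)))"

text \<open>On representatives, the inclusion \<open>I\<^sub>\<rho>\<close> of \<open>H\<close> into \<open>L\<^sup>2(\<rho>; TM)\<close> is the identity. The value
  of its adjoint is an everywhere defined field, an element of \<open>H\<close>; it is unique because \<open>ip\<close> is
  definite on \<open>H\<close>. \<open>M_op\<close> is only meaningful on \<open>horizontal M \<rho>\<close>.\<close>

definition incl :: "('a, 'n) vfield \<Rightarrow> ('a, 'n) vfield" where
  "incl w = w"

definition incl_adj ::
  "('a, 'n::finite, 'z) riem_scheme \<Rightarrow> ('a \<Rightarrow> real) \<Rightarrow> ('a, 'n) vfield set \<Rightarrow>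
    (('a, 'n) vfield \<Rightarrow> ('a, 'n) vfield \<Rightarrow> real) \<Rightarrow> ('a, 'n) vfield \<Rightarrow> ('a, 'n) vfield" where
  "incl_adj M \<rho> H ip v = (THE w. w \<in> H \<and> (\<forall>u\<in>H. ip u w = L2_inner M \<rho> (incl u) v))"

definition S_op ::
  "('a, 'n::finite, 'z) riem_scheme \<Rightarrow> ('a \<Rightarrow> real) \<Rightarrow> ('a, 'n) vfield set \<Rightarrow>
    (('a, 'n) vfield \<Rightarrow> ('a, 'n) vfield \<Rightarrow> real) \<Rightarrow> ('a, 'n) vfield \<Rightarrow> ('a, 'n) vfield" where
  "S_op M \<rho> H ip v = incl (incl_adj M \<rho> H ip v)"

definition M_op ::
  "('a::topological_space, 'n::finite, 'z) riem_scheme \<Rightarrow> ('a \<Rightarrow> real) \<Rightarrow> ('a, 'n) vfield set \<Rightarrow>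
    (('a, 'n) vfield \<Rightarrow> ('a, 'n) vfield \<Rightarrow> real) \<Rightarrow> ('a, 'n) vfield \<Rightarrow> ('a, 'n) vfield" where
  "M_op M \<rho> H ip v = hor_proj M \<rho> (S_op M \<rho> H ip v)"


section \<open>Density tangents\<close>

text \<open>Distributions are functionals on smooth functions, set to zero on all other
  functions, so that equality of distributions is equality of HOL functions. The divergence
  is the distributional one throughout.\<close>

type_synonym 'a distribution = "('a \<Rightarrow> real) \<Rightarrow> real"

definition distr_div ::
  "('a, 'n::finite, 'z) riem_scheme \<Rightarrow> ('a, 'n) vfield \<Rightarrow> 'a distribution" where
  "distr_div M X =
     (\<lambda>h. if smooth_fun M h then - (\<integral>p. gmet M p (X p) (grad M h p) \<partial>dvol M) else 0)"

definition A_op ::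
  "('a, 'n::finite, 'z) riem_scheme \<Rightarrow> ('a \<Rightarrow> real) \<Rightarrow> ('a, 'n) vfield \<Rightarrow> 'a distribution" where
  "A_op M \<rho> v = - distr_div M (fscale \<rho> v)"

definition ker_A ::
  "('a::topological_space, 'n::finite, 'z) riem_scheme \<Rightarrow> ('a \<Rightarrow> real) \<Rightarrow> ('a, 'n) vfield set" where
  "ker_A M \<rho> = {v \<in> L2_vf M \<rho>. A_op M \<rho> v = 0}"

definition K_W ::
  "('a, 'n::finite, 'z) riem_scheme \<Rightarrow> ('a \<Rightarrow> real) \<Rightarrow> ('a \<Rightarrow> real) \<Rightarrow> 'a distribution" where
  "K_W M \<rho> f = - distr_div M (fscale \<rho> (grad M f))"

definition K_S ::
  "('a, 'n::finite, 'z) riem_scheme \<Rightarrow> ('a \<Rightarrow> real) \<Rightarrow> ('a, 'n) vfield set \<Rightarrow>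
    (('a, 'n) vfield \<Rightarrow> ('a, 'n) vfield \<Rightarrow> real) \<Rightarrow> ('a \<Rightarrow> real) \<Rightarrow> 'a distribution" where
  "K_S M \<rho> H ip f = - distr_div M (fscale \<rho> (incl_adj M \<rho> H ip (grad M f)))"


section \<open>The homogeneous dual Sobolev norm\<close>

text \<open>\<open>H\<^sup>1(M)\<close> is the completion of the smooth functions in the \<open>H\<^sup>1\<close> norm, realised as the
  closure of the graph of the gradient in \<open>L\<^sup>2(M) \<times> L\<^sup>2(M; TM)\<close>; a Sobolev function is
  carried together with its weak gradient.\<close>

definition H1 ::
  "('a::topological_space, 'n::finite, 'z) riem_scheme \<Rightarrow> (('a \<Rightarrow> real) \<times> ('a, 'n) vfield) set" where
  "H1 M = {(u, V).
     u \<in> borel_measurable borel \<and> integrable (dvol M) (\<lambda>p. (u p)\<^sup>2) \<and> V \<in> L2_vf M (\<lambda>_. 1) \<and>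
     (\<exists>h. (\<forall>n::nat. smooth_fun M (h n)) \<and>
        (\<lambda>n. sqrt (\<integral>p. (h n p - u p)\<^sup>2 \<partial>dvol M)) \<longlonglongrightarrow> 0 \<and>
        (\<lambda>n. L2_norm M (\<lambda>_. 1) (grad M (h n) - V)) \<longlonglongrightarrow> 0)}"

text \<open>The bounded linear functionals on \<open>H\<^sup>1(M)/\<real>\<close> for the norm of the inner product
  \<open>\<integral> \<rho> \<langle>grad f, grad h\<rangle> dvol\<close>, written as functionals on \<open>H\<^sup>1(M)\<close>: the bound makes them
  vanish on constants and compatible with equality almost everywhere.\<close>

definition Hdot_dual ::
  "('a::topological_space, 'n::finite, 'z) riem_scheme \<Rightarrow> ('a \<Rightarrow> real) \<Rightarrow>
    (('a \<Rightarrow> real) \<times> ('a, 'n) vfield \<Rightarrow> real) set" where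
  "Hdot_dual M \<rho> = {\<Lambda>.
     (\<forall>u V u' V'. (u, V) \<in> H1 M \<and> (u', V') \<in> H1 M \<longrightarrow>
        \<Lambda> (u + u', V + V') = \<Lambda> (u, V) + \<Lambda> (u', V')) \<and>
     (\<forall>r u V. (u, V) \<in> H1 M \<longrightarrow> \<Lambda> (\<lambda>p. r * u p, fscale (\<lambda>_. r) V) = r * \<Lambda> (u, V)) \<and>
     (\<exists>C. \<forall>u V. (u, V) \<in> H1 M \<longrightarrow> \<bar>\<Lambda> (u, V)\<bar> \<le> C * L2_norm M \<rho> V)}"

definition Hdot_dual_norm ::
  "('a::topological_space, 'n::finite, 'z) riem_scheme \<Rightarrow> ('a \<Rightarrow> real) \<Rightarrow>
    (('a \<Rightarrow> real) \<times> ('a, 'n) vfield \<Rightarrow> real) \<Rightarrow> real" where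
  "Hdot_dual_norm M \<rho> \<Lambda> = Sup {\<bar>\<Lambda> (u, V)\<bar> | u V. (u, V) \<in> H1 M \<and> L2_norm M \<rho> V \<le> 1}"

text \<open>A distribution lies in the dual space if it extends to a bounded functional. The extension
  is unique on \<open>H1 M\<close>, since smooth functions are dense.\<close>

definition extends_distr ::
  "('a, 'n::finite, 'z) riem_scheme \<Rightarrow> (('a \<Rightarrow> real) \<times> ('a, 'n) vfield \<Rightarrow> real) \<Rightarrow>
    'a distribution \<Rightarrow> bool" where
  "extends_distr M \<Lambda> T \<longleftrightarrow> (\<forall>h. smooth_fun M h \<longrightarrow> \<Lambda> (h, grad M h) = T h)"

definition in_Hdot_minus1 ::
  "('a::topological_space, 'n::finite, 'z) riem_scheme \<Rightarrow> ('a \<Rightarrow> real) \<Rightarrow> 'a distribution \<Rightarrow> bool" where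
  "in_Hdot_minus1 M \<rho> T \<longleftrightarrow> (\<exists>\<Lambda>\<in>Hdot_dual M \<rho>. extends_distr M \<Lambda> T)"

definition Hdot_minus1_norm ::
  "('a::topological_space, 'n::finite, 'z) riem_scheme \<Rightarrow> ('a \<Rightarrow> real) \<Rightarrow> 'a distribution \<Rightarrow> real" where
  "Hdot_minus1_norm M \<rho> T =
     (THE r. \<exists>\<Lambda>\<in>Hdot_dual M \<rho>. extends_distr M \<Lambda> T \<and> r = Hdot_dual_norm M \<rho> \<Lambda>)"

end

theory Submission
  imports Defs
begin

text \<open>Write \<open>v\<close> for the gradient of \<open>f\<close>, \<open>w\<close> for its image under \<open>S_op\<close>, \<open>P\<close> for the horizontal
projection of \<open>w\<close> and \<open>D = P - v\<close>. Tested against a smooth function \<open>h\<close>, the Otto tangent is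
\<open>\<langle>v, grad h\<rangle>\<close> and the Stein tangent is \<open>\<langle>w, grad h\<rangle>\<close>, in the inner product of \<open>L\<^sup>2(\<rho>; TM)\<close>.
As \<open>w - P\<close> is orthogonal to all gradients, the difference of the two tangents is
\<open>h \<mapsto> \<langle>D, grad h\<rangle>\<close>, and \<open>D\<close> is horizontal. Everything follows from this. A horizontal field that is
orthogonal to all gradients is orthogonal to itself (\<open>orthogonal_to_gradients\<close>), so the tangents
agree exactly when \<open>D\<close> vanishes almost everywhere; and when they agree, \<open>w - v\<close> is
orthogonal to gradients, hence vertical. As gradients are dense in the horizontal fields, the functional
represented by a horizontal \<open>D\<close> has dual norm equal to the norm of \<open>D\<close>, and its extension
to Sobolev functions is unique (\<open>Hdot_minus1_horizontal\<close>). The assertion on particle fields is a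
change of sign.

The substance lies in showing that the objects exist. The gradient exists because the Gram matrix of a
chart is invertible; Cramer's rule moreover shows that its components are continuous. The
projection and the adjoint of the inclusion come from one Riesz representation theorem
(\<open>riesz_representation\<close>), which needs two inputs:

\<^item> completeness, which is part of the hypotheses for the reproducing kernel space and is a
Riesz-Fischer argument for vector fields in the case of \<open>L\<^sup>2\<close> (\<open>L2_complete\<close>);

\<^item> boundedness of the inclusion, which holds because the \<open>C\<^sup>1\<close> estimate bounds the evaluation of
fields near every point, and finitely many such neighbourhoods cover \<open>M\<close>
(\<open>bounded_evaluation\<close>).

The volume is finite because a continuous positive density on a compact space is bounded below, while
its integral is \<open>1\<close>.\<close>

section \<open>Semi-inner product spaces\<close>

text \<open>A quadratic polynomial without sign change has nonpositive discriminant. It yields both the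
Cauchy-Schwarz inequality and, with a small constant term, the fact that an almost minimiser of an energy
has almost vanishing derivative.\<close>

lemma discriminant_bound:
  fixes a b e :: real
  assumes "\<And>t. 0 \<le> e + 2 * a * t + b * t\<^sup>2" and "b \<ge> 0"
  shows "a\<^sup>2 \<le> e * b"
proof (cases "b = 0")
  case True
  have "a = 0"
  proof (rule ccontr)
    assume "a \<noteq> 0"
    then show False
      using assms(1)[of "- (e + 1) / (2 * a)"] True by (simp add: field_simps)
  qed
  then show ?thesis using True by simp
next
  case False
  then have "b > 0" using assms(2) by simp
  then show ?thesis
    using assms(1)[of "- a / b"] by (simp add: field_simps power2_eq_square)
qed

text \<open>The form is only semidefinite, since square integrable fields are represented by functions and
two representatives of the same class have distance zero. The scaling is a parameter because tangent
vectors and fields are scaled by different operations. Instances are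
tangent spaces, square integrable fields, horizontal fields and reproducing kernel spaces.\<close>

locale semi_inner_space =
  fixes V :: "'v::ab_group_add set" and sc :: "real \<Rightarrow> 'v \<Rightarrow> 'v" and B :: "'v \<Rightarrow> 'v \<Rightarrow> real"
  assumes zero_mem: "0 \<in> V"
    and add_mem: "u \<in> V \<Longrightarrow> v \<in> V \<Longrightarrow> u + v \<in> V"
    and sc_mem: "u \<in> V \<Longrightarrow> sc r u \<in> V"
    and sc_minus1: "u \<in> V \<Longrightarrow> sc (-1) u = - u"
    and sym: "u \<in> V \<Longrightarrow> v \<in> V \<Longrightarrow> B u v = B v u"
    and add_left: "u \<in> V \<Longrightarrow> v \<in> V \<Longrightarrow> w \<in> V \<Longrightarrow> B (u + w) v = B u v + B w v"
    and sc_left: "u \<in> V \<Longrightarrow> v \<in> V \<Longrightarrow> B (sc r u) v = r * B u v"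
    and nonneg: "u \<in> V \<Longrightarrow> B u u \<ge> 0"
begin

definition N :: "'v \<Rightarrow> real" where
  "N u = sqrt (B u u)"

lemma N_nonneg: "u \<in> V \<Longrightarrow> N u \<ge> 0"
  by (simp add: N_def nonneg)

lemma N_squared: "u \<in> V \<Longrightarrow> (N u)\<^sup>2 = B u u"
  by (simp add: N_def nonneg)

lemma minus_mem: "u \<in> V \<Longrightarrow> - u \<in> V"
  using sc_mem[of u "-1"] sc_minus1[of u] by simp

lemma diff_mem: "u \<in> V \<Longrightarrow> v \<in> V \<Longrightarrow> u - v \<in> V"
  using add_mem[OF _ minus_mem, of u v] by simp

lemma minus_left: "u \<in> V \<Longrightarrow> v \<in> V \<Longrightarrow> B (- u) v = - B u v"
  using sc_left[of u v "-1"] sc_minus1[of u] by simp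

lemma diff_left: "u \<in> V \<Longrightarrow> v \<in> V \<Longrightarrow> w \<in> V \<Longrightarrow> B (u - w) v = B u v - B w v"
  using add_left[OF _ _ minus_mem, of u v w] minus_left[of w v] by simp

lemma add_right: "u \<in> V \<Longrightarrow> v \<in> V \<Longrightarrow> w \<in> V \<Longrightarrow> B u (v + w) = B u v + B u w"
  by (simp add: sym[of u] add_left add_mem)

lemma diff_right: "u \<in> V \<Longrightarrow> v \<in> V \<Longrightarrow> w \<in> V \<Longrightarrow> B u (v - w) = B u v - B u w"
  by (simp add: sym[of u] diff_left diff_mem)

lemma sc_right: "u \<in> V \<Longrightarrow> v \<in> V \<Longrightarrow> B u (sc r v) = r * B u v"
  by (simp add: sym[of u] sc_left sc_mem)

lemma N_minus_commute: "u \<in> V \<Longrightarrow> v \<in> V \<Longrightarrow> N (u - v) = N (v - u)"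
  unfolding N_def by (simp add: diff_left diff_right diff_mem sym[of u v])

lemma N_sc: "u \<in> V \<Longrightarrow> N (sc r u) = \<bar>r\<bar> * N u"
  unfolding N_def by (simp add: sc_left sc_right sc_mem real_sqrt_mult flip: mult.assoc)

lemma line_expand:
  assumes "u \<in> V" "v \<in> V"
  shows "B (u + sc t v) (u + sc t v) = B u u + 2 * B u v * t + B v v * t\<^sup>2"
  using assms
  by (simp add: add_left add_right sc_left sc_right sc_mem add_mem sym[of v u]
      power2_eq_square algebra_simps)

lemma cauchy_schwarz:
  assumes "u \<in> V" "v \<in> V"
  shows "\<bar>B u v\<bar> \<le> N u * N v"
proof -
  have "(B u v)\<^sup>2 \<le> B u u * B v v"
  proof (rule discriminant_bound)
    fix t
    show "0 \<le> B u u + 2 * B u v * t + B v v * t\<^sup>2"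
      using nonneg[OF add_mem[OF assms(1) sc_mem[OF assms(2), of t]]] line_expand[OF assms]
      by simp
  qed (simp add: nonneg assms)
  then have "(B u v)\<^sup>2 \<le> (N u * N v)\<^sup>2"
    by (simp add: power_mult_distrib N_squared assms)
  then show ?thesis
    using assms by (simp add: abs_le_square_iff N_nonneg flip: abs_le_square_iff)
qed

lemma triangle:
  assumes "u \<in> V" "v \<in> V"
  shows "N (u + v) \<le> N u + N v"
proof (rule power2_le_imp_le)
  have "(N (u + v))\<^sup>2 = B u u + 2 * B u v + B v v"
    using assms by (simp add: N_squared add_mem add_left add_right sym[of v u])
  also have "\<dots> \<le> (N u + N v)\<^sup>2"
    using cauchy_schwarz[OF assms] by (simp add: N_squared[symmetric] assms power2_sum)
  finally show "(N (u + v))\<^sup>2 \<le> (N u + N v)\<^sup>2" .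
qed (simp add: N_nonneg assms)

definition complete where
  "complete \<longleftrightarrow> (\<forall>s. (\<forall>n::nat. s n \<in> V) \<and> (\<forall>\<epsilon>>0. \<exists>K. \<forall>m\<ge>K. \<forall>n\<ge>K. N (s m - s n) < \<epsilon>) \<longrightarrow>
     (\<exists>v\<in>V. (\<lambda>n. N (s n - v)) \<longlonglongrightarrow> 0))"

text \<open>The representing vector minimises \<open>J u = B u u - 2 * l u\<close>. By the parallelogram identity every
minimising sequence is Cauchy; at its members the derivative of \<open>J\<close> is small, so it vanishes at the
limit. With the form itself as functional this is the orthogonal projection onto a complete subspace.\<close>

theorem riesz_representation:
  assumes compl: complete
    and l_add: "\<And>u v. u \<in> V \<Longrightarrow> v \<in> V \<Longrightarrow> l (u + v) = l u + l v"
    and l_sc: "\<And>u r. u \<in> V \<Longrightarrow> l (sc r u) = r * l u"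
    and l_bound: "\<And>u. u \<in> V \<Longrightarrow> \<bar>l u\<bar> \<le> C * N u"
  shows "\<exists>w\<in>V. \<forall>u\<in>V. B w u = l u"
proof -
  define J where "J u = B u u - 2 * l u" for u
  have J_bound: "J u \<ge> - C\<^sup>2" if "u \<in> V" for u
  proof -
    have "0 \<le> (N u - C)\<^sup>2" by simp
    then have "- C\<^sup>2 \<le> (N u)\<^sup>2 - 2 * (C * N u)" by (simp add: power2_diff algebra_simps)
    then show ?thesis using l_bound[OF that] by (simp add: J_def N_squared that)
  qed
  define m where "m = Inf (J ` V)"
  have bdd: "bdd_below (J ` V)" using J_bound by (auto intro!: bdd_belowI)
  have m_le: "m \<le> J u" if "u \<in> V" for u
    unfolding m_def using bdd that by (auto intro: cInf_lower)
  have "\<exists>u\<in>V. J u < m + 1 / real (Suc n)" for n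
  proof -
    have "Inf (J ` V) < m + 1 / real (Suc n)" by (simp add: m_def)
    then show ?thesis using bdd zero_mem by (subst (asm) cInf_less_iff) auto
  qed
  then obtain s where s: "\<And>n. s n \<in> V" "\<And>n. J (s n) < m + 1 / real (Suc n)" by metis
  \<comment> \<open>the parallelogram identity, with the value of \<open>J\<close> at the midpoint bounded below by \<open>m\<close>\<close>
  have para: "(N (u - v))\<^sup>2 \<le> 2 * J u + 2 * J v - 4 * m" if "u \<in> V" "v \<in> V" for u v
  proof -
    have "m \<le> J (sc (1/2) (u + v))" using that by (intro m_le sc_mem add_mem)
    also have "\<dots> = (B u u + 2 * B u v + B v v) / 4 - l u - l v"
      using that by (simp add: J_def sc_left sc_right sc_mem add_mem add_left add_right
          sym[of v u] l_sc l_add field_simps)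
    finally show ?thesis
      using that by (simp add: J_def N_squared diff_mem diff_left diff_right sym[of v u]
          field_simps)
  qed
  have cauchy: "\<exists>K. \<forall>i\<ge>K. \<forall>j\<ge>K. N (s i - s j) < \<epsilon>" if "\<epsilon> > 0" for \<epsilon>
  proof -
    have "\<epsilon>\<^sup>2 / 4 > 0" using that by simp
    then obtain K where K: "inverse (real (Suc K)) < \<epsilon>\<^sup>2 / 4"
      using reals_Archimedean by blast
    have small: "J (s i) - m < \<epsilon>\<^sup>2 / 4" if "i \<ge> K" for i
    proof -
      have "1 / real (Suc i) \<le> inverse (real (Suc K))"
        using that by (simp add: field_simps)
      then show ?thesis using s(2)[of i] K by linarith
    qed
    have "N (s i - s j) < \<epsilon>" if "i \<ge> K" "j \<ge> K" for i j
    proof (rule power2_less_imp_less)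
      show "(N (s i - s j))\<^sup>2 < \<epsilon>\<^sup>2"
        using para[OF s(1) s(1), of i j] small[OF that(1)] small[OF that(2)] by linarith
    qed (use \<open>\<epsilon> > 0\<close> in simp)
    then show ?thesis by blast
  qed
  have "\<exists>w\<in>V. (\<lambda>n. N (s n - w)) \<longlonglongrightarrow> 0"
    by (rule compl[unfolded complete_def, THEN spec, THEN mp]) (simp add: s(1) cauchy)
  then obtain w where w: "w \<in> V" "(\<lambda>n. N (s n - w)) \<longlonglongrightarrow> 0" by blast
  have "B w u = l u" if u: "u \<in> V" for u
  proof -
    \<comment> \<open>\<open>J\<close> exceeds its infimum by at most \<open>1 / Suc n\<close> at \<open>s n\<close>, so it cannot decrease by more along the line through \<open>s n\<close> in direction \<open>u\<close>\<close>
    have slope: "\<bar>B (s n) u - l u\<bar> \<le> sqrt (1 / real (Suc n)) * N u" for n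
    proof -
      have "(B (s n) u - l u)\<^sup>2 \<le> (1 / real (Suc n)) * B u u"
      proof (rule discriminant_bound)
        fix t
        have "m \<le> J (s n + sc t u)" using s(1) u by (intro m_le add_mem sc_mem)
        also have "\<dots> = J (s n) + 2 * (B (s n) u - l u) * t + B u u * t\<^sup>2"
          using s(1)[of n] u by (simp add: J_def line_expand l_add l_sc sc_mem algebra_simps)
        finally show "0 \<le> 1 / real (Suc n) + 2 * (B (s n) u - l u) * t + B u u * t\<^sup>2"
          using s(2)[of n] by linarith
      qed (simp add: nonneg u)
      then have "sqrt ((B (s n) u - l u)\<^sup>2) \<le> sqrt ((1 / real (Suc n)) * B u u)"
        by (rule real_sqrt_le_mono)
      then show ?thesis unfolding N_def by (simp only: real_sqrt_abs real_sqrt_mult)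
    qed
    have "\<bar>B w u - l u\<bar> \<le> N (s n - w) * N u + sqrt (1 / real (Suc n)) * N u" for n
      using slope[of n] cauchy_schwarz[OF diff_mem[OF s(1)[of n] w(1)] u]
      unfolding diff_left[OF s(1)[of n] u w(1)] by linarith
    moreover have "(\<lambda>n. N (s n - w) * N u + sqrt (1 / real (Suc n)) * N u)
        \<longlonglongrightarrow> 0 * N u + sqrt 0 * N u"
      by (intro tendsto_intros w(2) LIMSEQ_Suc[OF lim_1_over_n])
    ultimately have "\<bar>B w u - l u\<bar> \<le> 0 * N u + sqrt 0 * N u"
      by (intro LIMSEQ_le_const) blast+
    then show ?thesis by simp
  qed
  then show ?thesis using w(1) by blast
qed

end

section \<open>Smooth functions\<close>

text \<open>A derivative at a point of the open set depends only on the values nearby.\<close>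

lemma Ck_on_cong:
  assumes "open U" "\<And>x. x \<in> U \<Longrightarrow> f x = g x" "Ck_on k U f"
  shows "Ck_on k U g"
  using assms(2,3)
proof (induction k arbitrary: f g)
  case 0
  then show ?case by (simp cong: continuous_on_cong)
next
  case (Suc k)
  have der: "(g has_derivative frechet_derivative f (at x)) (at x)" if "x \<in> U" for x
    using has_derivative_transform_within_open[OF _ assms(1) that, of f _ UNIV g] Suc.prems that
    by (simp add: frechet_derivative_works)
  then have eq: "frechet_derivative g (at x) = frechet_derivative f (at x)" if "x \<in> U" for x
    using frechet_derivative_at that by metis
  show ?case
    using der Suc.prems eq Suc.IH[of "\<lambda>x. frechet_derivative f (at x) v"
        "\<lambda>x. frechet_derivative g (at x) v" for v]
    by (auto simp: differentiable_def)
qed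

lemma Ck_on_lincomb:
  fixes f g :: "'e::real_normed_vector \<Rightarrow> 'f::real_normed_vector"
  assumes "open U" "Ck_on k U f" "Ck_on k U g"
  shows "Ck_on k U (\<lambda>x. a *\<^sub>R f x + b *\<^sub>R g x)"
  using assms(2,3)
proof (induction k arbitrary: f g)
  case 0
  then show ?case by (auto intro!: continuous_intros)
next
  case (Suc k)
  let ?D = "\<lambda>f x. frechet_derivative f (at x)"
  have der: "((\<lambda>x. a *\<^sub>R f x + b *\<^sub>R g x) has_derivative (\<lambda>v. a *\<^sub>R ?D f x v + b *\<^sub>R ?D g x v)) (at x)"
    if "x \<in> U" for x
    using Suc.prems that
    by (intro derivative_intros) (auto simp: frechet_derivative_works)
  have "?D (\<lambda>x. a *\<^sub>R f x + b *\<^sub>R g x) x = (\<lambda>v. a *\<^sub>R ?D f x v + b *\<^sub>R ?D g x v)" if "x \<in> U" for x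
    using frechet_derivative_at[OF der[OF that]] by simp
  then show ?case
    using der Suc.prems
    by (auto simp: differentiable_def
        intro: Ck_on_cong[OF assms(1) _ Suc.IH[of "\<lambda>x. ?D f x v" "\<lambda>x. ?D g x v" for v]])
qed

lemma smooth_on_differentiable:
  "smooth_on U f \<Longrightarrow> x \<in> U \<Longrightarrow> (f has_derivative frechet_derivative f (at x)) (at x)"
  unfolding smooth_on_def frechet_derivative_works[symmetric]
  by (metis Ck_on.simps(2))

lemma smooth_on_continuous: "smooth_on U f \<Longrightarrow> continuous_on U f"
  unfolding smooth_on_def by (metis Ck_on.simps(1))

lemma smooth_on_continuous_derivative:
  "smooth_on U f \<Longrightarrow> continuous_on U (\<lambda>x. frechet_derivative f (at x) v)"
  unfolding smooth_on_def by (metis Ck_on.simps)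

lemma smooth_on_lincomb:
  "open U \<Longrightarrow> smooth_on U f \<Longrightarrow> smooth_on U g \<Longrightarrow> smooth_on U (\<lambda>x. a *\<^sub>R f x + b *\<^sub>R g x)"
  unfolding smooth_on_def by (blast intro: Ck_on_lincomb)

lemma smooth_on_zero:
  fixes U :: "'e::real_normed_vector set"
  shows "smooth_on U (\<lambda>_. 0 :: 'f::real_normed_vector)"
proof -
  have "Ck_on k U (\<lambda>_. 0 :: 'f)" for k
    by (induction k) simp_all
  then show ?thesis by (simp add: smooth_on_def)
qed

locale closed_riemannian =
  fixes M :: "('a::{t2_space, second_countable_topology}, 'n::finite) riem"
  assumes closed_riem: "closed_oriented_riemannian M"
begin

section \<open>Charts and tangent spaces\<close>

lemma
  assumes "c \<in> atlas M"
  shows open_chart: "open (fst c)"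
    and open_chart_image: "open (chart_image c)"
    and chart_inv_chart: "p \<in> fst c \<Longrightarrow> chart_inv c (snd c p) = p"
    and chart_chart_inv: "x \<in> chart_image c \<Longrightarrow> snd c (chart_inv c x) = x"
    and chart_inv_mem: "x \<in> chart_image c \<Longrightarrow> chart_inv c x \<in> fst c"
    and chart_mem: "p \<in> fst c \<Longrightarrow> snd c p \<in> chart_image c"
    and continuous_chart: "continuous_on (fst c) (snd c)"
    and continuous_chart_inv: "continuous_on (chart_image c) (chart_inv c)"
proof -
  have *: "open (fst c)" "open (chart_image c)"
    "homeomorphism (fst c) (chart_image c) (snd c) (chart_inv c)"
    using closed_riem assms
    unfolding closed_oriented_riemannian_def oriented_smooth_atlas_def by blast+
  note h = *(3)[unfolded homeomorphism_def]
  show "open (fst c)" "open (chart_image c)" by fact+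
  show "p \<in> fst c \<Longrightarrow> chart_inv c (snd c p) = p" using h by blast
  show "x \<in> chart_image c \<Longrightarrow> snd c (chart_inv c x) = x" using h by blast
  show "x \<in> chart_image c \<Longrightarrow> chart_inv c x \<in> fst c" using h by blast
  show "p \<in> fst c \<Longrightarrow> snd c p \<in> chart_image c" using h by blast
  show "continuous_on (fst c) (snd c)" "continuous_on (chart_image c) (chart_inv c)"
    using h by blast+
qed

lemma charts_atD: "c \<in> charts_at M p \<Longrightarrow> c \<in> atlas M" "c \<in> charts_at M p \<Longrightarrow> p \<in> fst c"
  by (auto simp: charts_at_def)

lemma compact_manifold: "compact (UNIV :: 'a set)"
  using closed_riem by (simp add: closed_oriented_riemannian_def)

lemma charts_cover: "(\<Union>c\<in>atlas M. fst c) = UNIV"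
  using closed_riem unfolding closed_oriented_riemannian_def oriented_smooth_atlas_def by blast

lemma ex_chart: "\<exists>c. c \<in> charts_at M p"
  using charts_cover unfolding charts_at_def by blast

lemma chart_inv_of_charts_at: "c \<in> charts_at M p \<Longrightarrow> chart_inv c (snd c p) = p"
  by (simp add: charts_atD chart_inv_chart)

text \<open>Chart overlaps are open in coordinates, so identities between transition maps that hold there may be
differentiated.\<close>

lemma open_overlap:
  assumes "c \<in> atlas M" "d \<in> atlas M"
  shows "open (snd c ` (fst c \<inter> fst d))"
proof -
  have "snd c ` (fst c \<inter> fst d) = chart_image c \<inter> chart_inv c -` fst d"
    using chart_inv_chart[OF assms(1)] chart_chart_inv[OF assms(1)] chart_inv_mem[OF assms(1)]
      chart_mem[OF assms(1)]
    by (force simp: image_iff)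
  then show ?thesis
    using continuous_open_preimage[OF continuous_chart_inv open_chart_image open_chart] assms
    by simp
qed

lemma transition_has_derivative:
  assumes "c \<in> charts_at M p" "d \<in> charts_at M p"
  shows "(transition c d has_derivative transition_deriv c d p) (at (snd c p))"
proof -
  have "smooth_on (snd c ` (fst c \<inter> fst d)) (transition c d)"
    using closed_riem assms
    unfolding closed_oriented_riemannian_def oriented_smooth_atlas_def charts_at_def by blast
  then show ?thesis
    unfolding transition_deriv_def
    by (rule smooth_on_differentiable) (use assms in \<open>auto simp: charts_at_def\<close>)
qed

lemma transition_deriv_linear:
  "c \<in> charts_at M p \<Longrightarrow> d \<in> charts_at M p \<Longrightarrow> linear (transition_deriv c d p)"
  by (rule has_derivative_linear[OF transition_has_derivative])

lemma transition_at: "c \<in> charts_at M p \<Longrightarrow> transition c d (snd c p) = snd d p"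
  by (simp add: transition_def chart_inv_of_charts_at)

lemma transition_deriv_self:
  assumes "c \<in> charts_at M p"
  shows "transition_deriv c c p a = a"
proof -
  have "((\<lambda>x. x) has_derivative transition_deriv c c p) (at (snd c p))"
    by (rule has_derivative_transform_within_open[OF transition_has_derivative[OF assms assms],
          where s = "chart_image c"])
      (use assms in \<open>auto simp: charts_at_def open_chart_image chart_mem transition_def
         chart_chart_inv\<close>)
  then have "transition_deriv c c p = (\<lambda>x. x)"
    using has_derivative_unique[OF _ has_derivative_ident] by blast
  then show ?thesis by simp
qed

lemma transition_deriv_cocycle:
  assumes "c \<in> charts_at M p" "d \<in> charts_at M p" "e \<in> charts_at M p"
  shows "transition_deriv d e p (transition_deriv c d p a) = transition_deriv c e p a"
proof -
  have "(transition d e \<circ> transition c d has_derivative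
      transition_deriv d e p \<circ> transition_deriv c d p) (at (snd c p))"
    by (rule diff_chain_at)
      (use assms in \<open>simp_all add: transition_has_derivative transition_at\<close>)
  then have "(transition c e has_derivative
      transition_deriv d e p \<circ> transition_deriv c d p) (at (snd c p))"
    by (rule has_derivative_transform_within_open[where s = "snd c ` (fst c \<inter> fst d)"])
      (use assms in \<open>auto simp: charts_at_def open_overlap transition_def chart_inv_chart\<close>)
  from has_derivative_unique[OF this transition_has_derivative[OF assms(1,3)]]
  show ?thesis by (metis comp_apply)
qed

text \<open>The transformation rule of tangent vectors, oriented so that the simplifier can use it without
looping.\<close>

lemma tangent_transform:
  "\<xi> \<in> tangent_space M p \<Longrightarrow> c \<in> charts_at M p \<Longrightarrow> d \<in> charts_at M p \<Longrightarrow>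
    transition_deriv c d p (\<xi> c) = \<xi> d"
  unfolding tangent_space_def by (drule CollectD) metis

lemma tangent_outside: "\<xi> \<in> tangent_space M p \<Longrightarrow> c \<notin> charts_at M p \<Longrightarrow> \<xi> c = 0"
  unfolding tangent_space_def by blast

lemma tangentI:
  assumes "\<And>c d. c \<in> charts_at M p \<Longrightarrow> d \<in> charts_at M p \<Longrightarrow> transition_deriv c d p (\<xi> c) = \<xi> d"
    and "\<And>c. c \<notin> charts_at M p \<Longrightarrow> \<xi> c = 0"
  shows "\<xi> \<in> tangent_space M p"
  unfolding tangent_space_def using assms by (intro CollectI conjI ballI allI impI) metis+

text \<open>By the cocycle rule, tangent vectors at a point correspond to their coordinates in any one chart.\<close>

lemma tangent_of_mem: "c \<in> charts_at M p \<Longrightarrow> tangent_of M c p a \<in> tangent_space M p"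
  by (rule tangentI) (auto simp: tangent_of_def transition_deriv_cocycle)

lemma tangent_of_coord: "c \<in> charts_at M p \<Longrightarrow> tangent_of M c p a c = a"
  unfolding tangent_of_def by (simp add: transition_deriv_self)

lemma tangent_of_coordinates:
  "c \<in> charts_at M p \<Longrightarrow> \<xi> \<in> tangent_space M p \<Longrightarrow> tangent_of M c p (\<xi> c) = \<xi>"
  by (rule ext) (simp add: tangent_of_def tangent_transform tangent_outside)

lemma tangent_of_add:
  "c \<in> charts_at M p \<Longrightarrow> tangent_of M c p (a + b) = tangent_of M c p a + tangent_of M c p b"
  unfolding tangent_of_def by (auto simp: linear_add[OF transition_deriv_linear])

lemma tangent_of_scale:
  "c \<in> charts_at M p \<Longrightarrow> tangent_of M c p (r *\<^sub>R a) = tscale r (tangent_of M c p a)"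
  unfolding tangent_of_def tscale_def by (auto simp: linear_scale[OF transition_deriv_linear])

lemma tangent_add:
  "\<xi> \<in> tangent_space M p \<Longrightarrow> \<eta> \<in> tangent_space M p \<Longrightarrow> \<xi> + \<eta> \<in> tangent_space M p"
  by (rule tangentI)
    (auto simp: linear_add[OF transition_deriv_linear] tangent_transform tangent_outside)

lemma tangent_scale: "\<xi> \<in> tangent_space M p \<Longrightarrow> tscale r \<xi> \<in> tangent_space M p"
  by (rule tangentI)
    (auto simp: tscale_def linear_scale[OF transition_deriv_linear] tangent_transform tangent_outside)

lemma tangent_zero: "0 \<in> tangent_space M p"
  by (rule tangentI) (auto simp: linear_0[OF transition_deriv_linear])

lemma tscale_minus1: "tscale (-1) \<xi> = - \<xi>"
  by (auto simp: tscale_def)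

lemma tangent_minus: "\<xi> \<in> tangent_space M p \<Longrightarrow> - \<xi> \<in> tangent_space M p"
  using tangent_scale[of \<xi> p "-1"] by (simp add: tscale_minus1)

lemma tangent_diff:
  "\<xi> \<in> tangent_space M p \<Longrightarrow> \<eta> \<in> tangent_space M p \<Longrightarrow> \<xi> - \<eta> \<in> tangent_space M p"
  using tangent_add[OF _ tangent_minus, of \<xi> p \<eta>] by simp

section \<open>The metric in a chart\<close>

lemma
  assumes "\<xi> \<in> tangent_space M p" "\<eta> \<in> tangent_space M p"
  shows gmet_sym: "gmet M p \<xi> \<eta> = gmet M p \<eta> \<xi>"
    and gmet_add_left: "\<zeta> \<in> tangent_space M p \<Longrightarrow> gmet M p (\<xi> + \<zeta>) \<eta> = gmet M p \<xi> \<eta> + gmet M p \<zeta> \<eta>"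
    and gmet_scale_left: "gmet M p (tscale r \<xi>) \<eta> = r * gmet M p \<xi> \<eta>"
proof -
  have "riemannian_metric M" using closed_riem by (simp add: closed_oriented_riemannian_def)
  then have *: "\<forall>p. \<forall>\<xi>\<in>tangent_space M p. \<forall>\<eta>\<in>tangent_space M p. \<forall>\<zeta>\<in>tangent_space M p. \<forall>r.
        gmet M p \<xi> \<eta> = gmet M p \<eta> \<xi> \<and>
        gmet M p (\<xi> + \<zeta>) \<eta> = gmet M p \<xi> \<eta> + gmet M p \<zeta> \<eta> \<and>
        gmet M p (tscale r \<xi>) \<eta> = r * gmet M p \<xi> \<eta> \<and>
        (\<xi> \<noteq> 0 \<longrightarrow> gmet M p \<xi> \<xi> > 0)"
    unfolding riemannian_metric_def by blast
  show "gmet M p \<xi> \<eta> = gmet M p \<eta> \<xi>" using * assms by blast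
  show "\<zeta> \<in> tangent_space M p \<Longrightarrow> gmet M p (\<xi> + \<zeta>) \<eta> = gmet M p \<xi> \<eta> + gmet M p \<zeta> \<eta>"
    using * assms by blast
  show "gmet M p (tscale r \<xi>) \<eta> = r * gmet M p \<xi> \<eta>" using * assms by blast
qed

lemma gmet_pos: "\<xi> \<in> tangent_space M p \<Longrightarrow> \<xi> \<noteq> 0 \<Longrightarrow> gmet M p \<xi> \<xi> > 0"
  using closed_riem unfolding closed_oriented_riemannian_def riemannian_metric_def by blast

lemma gmet_zero_left: "\<eta> \<in> tangent_space M p \<Longrightarrow> gmet M p 0 \<eta> = 0"
  using gmet_scale_left[OF tangent_zero, of \<eta> p 0] by (simp add: tscale_def zero_fun_def)

lemma gmet_nonneg: "\<xi> \<in> tangent_space M p \<Longrightarrow> gmet M p \<xi> \<xi> \<ge> 0"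
  using gmet_pos gmet_zero_left by (metis less_eq_real_def)

lemma tangent_semi_inner: "semi_inner_space (tangent_space M p) tscale (gmet M p)"
  by unfold_locales
    (auto simp: tangent_zero tangent_add tangent_scale tscale_minus1 gmet_add_left gmet_scale_left
      gmet_nonneg intro: gmet_sym)

lemma gmet_coord:
  assumes c: "c \<in> charts_at M p" and "\<xi> \<in> tangent_space M p" "\<eta> \<in> tangent_space M p"
  shows "gmet M p \<xi> \<eta> = (\<Sum>i\<in>UNIV. \<Sum>j\<in>UNIV. \<xi> c $ i * \<eta> c $ j * gram M c p $ i $ j)"
proof -
  interpret T: semi_inner_space "tangent_space M p" tscale "gmet M p" by (rule tangent_semi_inner)
  let ?t = "tangent_of M c p"
  note mem = tangent_of_mem[OF c]
  have cv: "coord_vec M c p i \<in> tangent_space M p" for i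
    by (simp add: coord_vec_def mem)
  have lin: "linear (\<lambda>a. gmet M p (?t a) \<zeta>)" if "\<zeta> \<in> tangent_space M p" for \<zeta>
    by (rule linearI)
      (simp_all add: tangent_of_add[OF c] tangent_of_scale[OF c] gmet_add_left gmet_scale_left mem that)
  have expand: "gmet M p (?t a) \<zeta> = (\<Sum>i\<in>UNIV. a $ i * gmet M p (coord_vec M c p i) \<zeta>)"
    if "\<zeta> \<in> tangent_space M p" for a \<zeta>
  proof -
    have "gmet M p (?t a) \<zeta> = gmet M p (?t (\<Sum>i\<in>UNIV. a $ i *\<^sub>R axis i 1)) \<zeta>"
      using basis_expansion[of a] by (simp add: scalar_mult_eq_scaleR)
    also have "\<dots> = (\<Sum>i\<in>UNIV. a $ i * gmet M p (coord_vec M c p i) \<zeta>)"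
      by (simp add: linear_sum[OF lin[OF that]] linear_scale[OF lin[OF that]] coord_vec_def)
    finally show ?thesis .
  qed
  have "gmet M p \<xi> \<eta> = (\<Sum>i\<in>UNIV. \<xi> c $ i * gmet M p (coord_vec M c p i) \<eta>)"
    using expand[OF assms(3), of "\<xi> c"] tangent_of_coordinates[OF c assms(2)] by simp
  also have "\<dots> = (\<Sum>i\<in>UNIV. \<xi> c $ i * gmet M p (?t (\<eta> c)) (coord_vec M c p i))"
    using assms(3) cv by (simp add: tangent_of_coordinates[OF c] gmet_sym[of \<eta>])
  also have "\<dots> = (\<Sum>i\<in>UNIV. \<Sum>j\<in>UNIV. \<xi> c $ i * \<eta> c $ j * gmet M p (coord_vec M c p j) (coord_vec M c p i))"
    by (simp add: expand cv sum_distrib_left mult.assoc)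
  also have "\<dots> = (\<Sum>i\<in>UNIV. \<Sum>j\<in>UNIV. \<xi> c $ i * \<eta> c $ j * gram M c p $ i $ j)"
    unfolding gram_def by (simp add: gmet_sym[OF cv cv])
  finally show ?thesis .
qed

lemma gram_nonsingular:
  assumes c: "c \<in> charts_at M p"
  shows "det (gram M c p) \<noteq> 0"
proof -
  have "a = 0" if "gram M c p *v a = 0" for a
  proof (rule ccontr)
    let ?\<xi> = "tangent_of M c p a"
    note mem = tangent_of_mem[OF c, of a]
    assume "a \<noteq> 0"
    then have "?\<xi> \<noteq> 0" using tangent_of_coord[OF c, of a] by auto
    then have "gmet M p ?\<xi> ?\<xi> > 0" by (intro gmet_pos mem)
    moreover have "gmet M p ?\<xi> ?\<xi> = (\<Sum>i\<in>UNIV. a $ i * (gram M c p *v a) $ i)"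
      using gmet_coord[OF c mem mem]
      by (simp add: tangent_of_coord[OF c] matrix_vector_mult_def sum_distrib_left mult_ac)
    ultimately show False using that by simp
  qed
  then have "\<exists>B. B ** gram M c p = mat 1" by (subst matrix_left_invertible_ker) blast
  then show ?thesis
    by (simp add: invertible_det_nz[symmetric] invertible_left_inverse)
qed

lemma continuous_gram:
  assumes "c \<in> atlas M"
  shows "continuous_on (fst c) (\<lambda>p. gram M c p $ i $ j)"
proof -
  have "smooth_on (chart_image c) (\<lambda>x. gram M c (chart_inv c x) $ i $ j)"
    using closed_riem assms
    unfolding closed_oriented_riemannian_def riemannian_metric_def by blast
  then have "continuous_on (snd c ` fst c) (\<lambda>x. gram M c (chart_inv c x) $ i $ j)"
    unfolding chart_image_def[symmetric] by (rule smooth_on_continuous)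
  from continuous_on_compose2[OF this continuous_chart[OF assms] order_refl]
  show ?thesis by (simp add: chart_inv_chart[OF assms] cong: continuous_on_cong)
qed

text \<open>Every coordinate is the inner product with a fixed tangent vector, namely the one whose coordinates
solve the Gram system for a unit vector. Hence Cauchy sequences for the metric converge in coordinates.\<close>

lemma coordinates_bounded_by_metric:
  assumes c: "c \<in> charts_at M p"
  shows "\<exists>C. \<forall>\<xi>\<in>tangent_space M p. norm (\<xi> c) \<le> C * sqrt (gmet M p \<xi> \<xi>)"
proof -
  interpret T: semi_inner_space "tangent_space M p" tscale "gmet M p" by (rule tangent_semi_inner)
  have "\<exists>x. gram M c p *v x = axis i 1" for i
    using cramer[OF gram_nonsingular[OF c]] by blast
  then obtain x where x: "\<And>i. gram M c p *v x i = axis i 1" by metis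
  let ?e = "\<lambda>i. tangent_of M c p (x i)"
  have "norm (\<xi> c) \<le> (\<Sum>i\<in>UNIV. T.N (?e i)) * sqrt (gmet M p \<xi> \<xi>)" if \<xi>: "\<xi> \<in> tangent_space M p" for \<xi>
  proof -
    have "gmet M p \<xi> (?e i) = (\<Sum>j\<in>UNIV. \<xi> c $ j * (gram M c p *v x i) $ j)" for i
      by (simp add: gmet_coord[OF c \<xi> tangent_of_mem[OF c]] tangent_of_coord[OF c]
          matrix_vector_mult_def sum_distrib_left mult_ac)
    then have comp: "\<xi> c $ i = gmet M p \<xi> (?e i)" for i
      by (simp add: x axis_def if_distrib cong: if_cong)
    have "norm (\<xi> c) \<le> (\<Sum>i\<in>UNIV. \<bar>\<xi> c $ i\<bar>)" by (rule norm_le_l1_cart)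
    also have "\<dots> \<le> (\<Sum>i\<in>UNIV. T.N (?e i) * T.N \<xi>)"
      unfolding comp using T.cauchy_schwarz[OF \<xi> tangent_of_mem[OF c]]
      by (intro sum_mono) (simp add: mult.commute)
    finally show ?thesis by (simp add: sum_distrib_right T.N_def)
  qed
  then show ?thesis by blast
qed

lemma abs_gmet_le:
  "\<xi> \<in> tangent_space M p \<Longrightarrow> \<eta> \<in> tangent_space M p \<Longrightarrow>
    \<bar>gmet M p \<xi> \<eta>\<bar> \<le> gmet M p \<xi> \<xi> + gmet M p \<eta> \<eta>"
proof -
  interpret T: semi_inner_space "tangent_space M p" tscale "gmet M p" by (rule tangent_semi_inner)
  assume *: "\<xi> \<in> tangent_space M p" "\<eta> \<in> tangent_space M p"
  have "T.N \<xi> * T.N \<eta> \<le> (T.N \<xi>)\<^sup>2 + (T.N \<eta>)\<^sup>2"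
    using sum_squares_bound[of "T.N \<xi>" "T.N \<eta>"] T.N_nonneg[OF *(1)] T.N_nonneg[OF *(2)]
      mult_nonneg_nonneg[of "T.N \<xi>" "T.N \<eta>"] by linarith
  then show ?thesis using T.cauchy_schwarz[OF *] by (simp add: T.N_squared *)
qed

section \<open>Vector fields\<close>

lemma vfieldD: "v \<in> vector_fields M \<Longrightarrow> v p \<in> tangent_space M p"
  by (simp add: vector_fields_def)

definition continuous_field :: "('a, 'n) vfield \<Rightarrow> bool" where
  "continuous_field v \<longleftrightarrow> v \<in> vector_fields M \<and> (\<forall>c\<in>atlas M. continuous_on (fst c) (\<lambda>p. v p c))"

text \<open>Chart domains form an open cover, so continuity may be checked on each of them.\<close>

lemma continuous_onI_charts:
  fixes \<phi> :: "'a \<Rightarrow> 'b::topological_space"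
  assumes "\<And>c. c \<in> atlas M \<Longrightarrow> continuous_on (fst c) \<phi>"
  shows "continuous_on UNIV \<phi>"
proof -
  have "continuous_on (\<Union>c\<in>atlas M. fst c) \<phi>"
    by (rule continuous_on_open_UN) (use assms open_chart in auto)
  then show ?thesis by (simp add: charts_cover)
qed

text \<open>The atlas may be uncountable; compactness reduces measurability to finitely many charts.\<close>

lemma measurable_charts:
  fixes \<phi> :: "'a \<Rightarrow> 'b::topological_space"
  assumes "\<And>c. c \<in> atlas M \<Longrightarrow> \<phi> \<in> borel_measurable (restrict_space borel (fst c))"
  shows "\<phi> \<in> borel_measurable borel"
proof -
  have cover: "UNIV \<subseteq> (\<Union>c\<in>atlas M. fst c)" by (simp add: charts_cover)
  obtain A where A: "A \<subseteq> atlas M" "finite A" "UNIV \<subseteq> (\<Union>c\<in>A. fst c)"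
    by (rule compactE_image[OF compact_manifold open_chart cover])
  show ?thesis
    by (rule measurable_piecewise_restrict[where C = "fst ` A"])
      (use A assms in \<open>auto intro!: countable_finite borel_open open_chart\<close>)
qed

lemma continuous_gmet:
  assumes u: "continuous_field u" and v: "continuous_field v"
  shows "continuous_on UNIV (\<lambda>p. gmet M p (u p) (v p))"
proof (rule continuous_onI_charts)
  fix c assume c: "c \<in> atlas M"
  have "continuous_on (fst c) (\<lambda>p. \<Sum>i\<in>UNIV. \<Sum>j\<in>UNIV. u p c $ i * v p c $ j * gram M c p $ i $ j)"
    using u v c unfolding continuous_field_def by (intro continuous_intros continuous_gram) auto
  then show "continuous_on (fst c) (\<lambda>p. gmet M p (u p) (v p))"
    by (rule continuous_on_eq) (use u v c in \<open>auto simp: continuous_field_def vfieldD charts_at_def gmet_coord\<close>)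
qed

lemma measurable_gmet:
  assumes u: "u \<in> vector_fields M" "\<And>c. c \<in> atlas M \<Longrightarrow> (\<lambda>p. u p c) \<in> borel_measurable borel"
    and v: "v \<in> vector_fields M" "\<And>c. c \<in> atlas M \<Longrightarrow> (\<lambda>p. v p c) \<in> borel_measurable borel"
  shows "(\<lambda>p. gmet M p (u p) (v p)) \<in> borel_measurable borel"
proof (rule measurable_charts)
  fix c assume c: "c \<in> atlas M"
  have comp: "(\<lambda>p. w p c $ i) \<in> borel_measurable (restrict_space borel (fst c))"
    if "(\<lambda>p. w p c) \<in> borel_measurable borel" for w :: "('a, 'n) vfield" and i
    by (intro measurable_restrict_space1 borel_measurable_continuous_on[OF _ that] continuous_intros)
  have "(\<lambda>p. \<Sum>i\<in>UNIV. \<Sum>j\<in>UNIV. u p c $ i * v p c $ j * gram M c p $ i $ j)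
      \<in> borel_measurable (restrict_space borel (fst c))"
    by (intro borel_measurable_sum borel_measurable_times comp u(2) v(2) c
        borel_measurable_continuous_on_restrict continuous_gram)
  moreover have "gmet M p (u p) (v p) = (\<Sum>i\<in>UNIV. \<Sum>j\<in>UNIV. u p c $ i * v p c $ j * gram M c p $ i $ j)"
    if "p \<in> fst c" for p
    using gmet_coord u v c that by (auto simp: vfieldD charts_at_def)
  ultimately show "(\<lambda>p. gmet M p (u p) (v p)) \<in> borel_measurable (restrict_space borel (fst c))"
    by (subst measurable_cong) (auto simp: space_restrict_space)
qed

lemma continuous_field_measurable:
  assumes "continuous_field v" "c \<in> atlas M"
  shows "(\<lambda>p. v p c) \<in> borel_measurable borel"
proof -
  have "(\<lambda>p. if p \<in> fst c then v p c else 0) \<in> borel_measurable borel"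
    using assms open_chart
    by (intro borel_measurable_continuous_on_if) (auto simp: continuous_field_def)
  moreover have "(if p \<in> fst c then v p c else 0) = v p c" for p
    using assms tangent_outside[of "v p" p c]
    by (auto simp: continuous_field_def vector_fields_def charts_at_def)
  ultimately show ?thesis by simp
qed

lemma
  assumes "u \<in> vector_fields M" "v \<in> vector_fields M"
  shows vector_fields_add: "u + v \<in> vector_fields M"
    and vector_fields_diff: "u - v \<in> vector_fields M"
  using assms by (simp_all add: vector_fields_def tangent_add tangent_diff)

lemma vector_fields_fscale: "v \<in> vector_fields M \<Longrightarrow> fscale \<phi> v \<in> vector_fields M"
  by (simp add: vector_fields_def fscale_def tangent_scale)

lemma vector_fields_zero: "0 \<in> vector_fields M"
  by (simp add: vector_fields_def tangent_zero)

lemma sets_volume: "sets (dvol M) = sets borel"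
  using closed_riem by (simp add: closed_oriented_riemannian_def riemannian_volume_def)

lemma space_volume: "space (dvol M) = UNIV"
  using sets_eq_imp_space_eq[OF sets_volume] by simp

lemma measurable_volume: "borel_measurable (dvol M) = borel_measurable borel"
  by (rule measurable_cong_sets) (simp_all add: sets_volume)

lemma fscale_minus1: "fscale (\<lambda>_. -1) v = - v"
  by (intro ext) (simp add: fscale_def tscale_def)

section \<open>Gradients\<close>

lemma smooth_has_derivative:
  assumes "smooth_fun M h" "c \<in> charts_at M p"
  shows "(h \<circ> chart_inv c has_derivative frechet_derivative (h \<circ> chart_inv c) (at (snd c p))) (at (snd c p))"
  by (rule smooth_on_differentiable[where U = "chart_image c"])
    (use assms in \<open>auto simp: smooth_fun_def charts_at_def chart_mem\<close>)

text \<open>The chain rule for a transition map makes the differential independent of the chosen chart.\<close>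

lemma differential_chart:
  assumes h: "smooth_fun M h" and c: "c \<in> charts_at M p" and \<eta>: "\<eta> \<in> tangent_space M p"
  shows "differential M h p \<eta> = frechet_derivative (h \<circ> chart_inv c) (at (snd c p)) (\<eta> c)"
proof -
  define d where "d = (SOME c. c \<in> charts_at M p)"
  have d: "d \<in> charts_at M p" unfolding d_def by (rule someI_ex[OF ex_chart])
  let ?D = "\<lambda>c. frechet_derivative (h \<circ> chart_inv c) (at (snd c p))"
  have "((h \<circ> chart_inv c) \<circ> transition d c has_derivative ?D c \<circ> transition_deriv d c p) (at (snd d p))"
    by (rule diff_chain_at)
      (use h c d in \<open>simp_all add: transition_has_derivative transition_at smooth_has_derivative\<close>)
  then have "(h \<circ> chart_inv d has_derivative ?D c \<circ> transition_deriv d c p) (at (snd d p))"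
    by (rule has_derivative_transform_within_open[where s = "snd d ` (fst d \<inter> fst c)"])
      (use c d in \<open>auto simp: charts_at_def open_overlap transition_def chart_inv_chart\<close>)
  from has_derivative_unique[OF this smooth_has_derivative[OF h d]]
  have "?D d (\<eta> d) = ?D c (transition_deriv d c p (\<eta> d))" by (metis comp_apply)
  moreover have "transition_deriv d c p (\<eta> d) = \<eta> c"
    by (rule tangent_transform[OF \<eta> d c])
  ultimately show ?thesis by (simp add: differential_def d_def[symmetric])
qed

text \<open>In a chart the equation for the gradient is a linear system with the Gram matrix. Its solution by
Cramer's rule is recorded because it is visibly continuous in the point.\<close>

lemma
  assumes h: "smooth_fun M h"
  shows grad_mem: "grad M h p \<in> tangent_space M p"
    and gmet_grad: "\<eta> \<in> tangent_space M p \<Longrightarrow> gmet M p (grad M h p) \<eta> = differential M h p \<eta>"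
    and grad_unique: "\<xi> \<in> tangent_space M p \<Longrightarrow>
      (\<And>\<eta>. \<eta> \<in> tangent_space M p \<Longrightarrow> gmet M p \<xi> \<eta> = differential M h p \<eta>) \<Longrightarrow> grad M h p = \<xi>"
    and grad_coord: "c \<in> charts_at M p \<Longrightarrow> grad M h p c =
      (\<chi> k. det (\<chi> i j. if j = k then frechet_derivative (h \<circ> chart_inv c) (at (snd c p)) (axis i 1)
        else gram M c p $ i $ j) / det (gram M c p))"
proof -
  let ?b = "\<lambda>c. \<chi> i. frechet_derivative (h \<circ> chart_inv c) (at (snd c p)) (axis i 1)"
  let ?P = "\<lambda>\<xi>. \<xi> \<in> tangent_space M p \<and>
    (\<forall>\<eta>\<in>tangent_space M p. gmet M p \<xi> \<eta> = differential M h p \<eta>)"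
  interpret T: semi_inner_space "tangent_space M p" tscale "gmet M p" by (rule tangent_semi_inner)
  have diff_sum: "differential M h p \<eta> = (\<Sum>i\<in>UNIV. \<eta> c $ i * ?b c $ i)"
    if "c \<in> charts_at M p" "\<eta> \<in> tangent_space M p" for c \<eta>
  proof -
    have lin: "linear (frechet_derivative (h \<circ> chart_inv c) (at (snd c p)))"
      by (rule has_derivative_linear[OF smooth_has_derivative[OF h that(1)]])
    have "differential M h p \<eta> =
        frechet_derivative (h \<circ> chart_inv c) (at (snd c p)) (\<Sum>i\<in>UNIV. \<eta> c $ i *\<^sub>R axis i 1)"
      using differential_chart[OF h that] basis_expansion[of "\<eta> c"] by (simp add: scalar_mult_eq_scaleR)
    then show ?thesis by (simp add: linear_sum[OF lin] linear_scale[OF lin])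
  qed
  have uniq: "\<xi> = \<xi>'" if "?P \<xi>" "?P \<xi>'" for \<xi> \<xi>'
  proof -
    have "gmet M p (\<xi> - \<xi>') (\<xi> - \<xi>') = 0"
      using that by (simp add: T.diff_left T.diff_mem)
    then show ?thesis using gmet_pos[of "\<xi> - \<xi>'" p] that T.diff_mem by force
  qed
  have cramer_P: "?P (tangent_of M c p x)"
    if c: "c \<in> charts_at M p" and x: "gram M c p *v x = ?b c" for c x
  proof (intro conjI ballI)
    fix \<eta> assume \<eta>: "\<eta> \<in> tangent_space M p"
    have "gmet M p (tangent_of M c p x) \<eta> = gmet M p \<eta> (tangent_of M c p x)"
      by (intro gmet_sym \<eta> tangent_of_mem c)
    also have "\<dots> = (\<Sum>i\<in>UNIV. \<eta> c $ i * (gram M c p *v x) $ i)"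
      by (simp add: gmet_coord[OF c \<eta> tangent_of_mem[OF c]] tangent_of_coord[OF c]
          matrix_vector_mult_def sum_distrib_left mult_ac)
    finally show "gmet M p (tangent_of M c p x) \<eta> = differential M h p \<eta>"
      unfolding x by (simp add: diff_sum[OF c \<eta>])
  qed (rule tangent_of_mem[OF c])
  have sol: "gram M c p *v (\<chi> k. det (\<chi> i j. if j = k then ?b c $ i else gram M c p $ i $ j) / det (gram M c p)) = ?b c"
    if "c \<in> charts_at M p" for c
    using cramer[OF gram_nonsingular[OF that]] by blast
  obtain c0 where c0: "c0 \<in> charts_at M p" using ex_chart by blast
  have ex1: "\<exists>!\<xi>. ?P \<xi>"
    using cramer_P[OF c0 sol[OF c0]] uniq by blast
  have P: "?P (grad M h p)"
    unfolding grad_def by (rule theI'[OF ex1])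
  show "grad M h p \<in> tangent_space M p" using P by blast
  show "\<eta> \<in> tangent_space M p \<Longrightarrow> gmet M p (grad M h p) \<eta> = differential M h p \<eta>" using P by blast
  show "grad M h p = \<xi>" if "\<xi> \<in> tangent_space M p"
    "\<And>\<eta>. \<eta> \<in> tangent_space M p \<Longrightarrow> gmet M p \<xi> \<eta> = differential M h p \<eta>"
    using uniq[OF P] that by blast
  show "grad M h p c = (\<chi> k. det (\<chi> i j. if j = k then frechet_derivative (h \<circ> chart_inv c) (at (snd c p)) (axis i 1)
        else gram M c p $ i $ j) / det (gram M c p))" if c: "c \<in> charts_at M p"
    using uniq[OF P cramer_P[OF c sol[OF c]]] tangent_of_coord[OF c] by (simp cong: if_cong)
qed

lemma continuous_field_grad:
  assumes h: "smooth_fun M h"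
  shows "continuous_field (grad M h)"
  unfolding continuous_field_def
proof (intro conjI ballI)
  show "grad M h \<in> vector_fields M" by (simp add: vector_fields_def grad_mem h)
  fix c assume c: "c \<in> atlas M"
  have b: "continuous_on (fst c) (\<lambda>p. frechet_derivative (h \<circ> chart_inv c) (at (snd c p)) a)" for a
    by (rule continuous_on_compose2[OF smooth_on_continuous_derivative continuous_chart[OF c]])
      (use h c in \<open>auto simp: smooth_fun_def chart_mem\<close>)
  have entry: "continuous_on (fst c) (\<lambda>p. if j = k
      then frechet_derivative (h \<circ> chart_inv c) (at (snd c p)) (axis i 1) else gram M c p $ i $ j)"
    for i j k
    by (cases "j = k") (simp_all add: b continuous_gram[OF c])
  have "continuous_on (fst c) (\<lambda>p. \<chi> k. det (\<chi> i j. if j = k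
      then frechet_derivative (h \<circ> chart_inv c) (at (snd c p)) (axis i 1)
        else gram M c p $ i $ j) / det (gram M c p))"
    by (intro continuous_intros)
      (use c gram_nonsingular in \<open>auto simp: det_def charts_at_def intro!: continuous_intros entry continuous_gram\<close>)
  then show "continuous_on (fst c) (\<lambda>p. grad M h p c)"
    by (rule continuous_on_eq) (use c in \<open>simp add: grad_coord[OF h] charts_at_def\<close>)
qed

lemma smooth_fun_lincomb:
  assumes "smooth_fun M g" "smooth_fun M h"
  shows "smooth_fun M (\<lambda>p. a * g p + b * h p)"
  unfolding smooth_fun_def
proof
  fix c assume "c \<in> atlas M"
  then show "smooth_on (chart_image c) ((\<lambda>p. a * g p + b * h p) \<circ> chart_inv c)"
    using smooth_on_lincomb[OF open_chart_image, of c "g \<circ> chart_inv c" "h \<circ> chart_inv c" a b] assms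
    by (auto simp: smooth_fun_def o_def)
qed

lemma grad_lincomb:
  assumes g: "smooth_fun M g" and h: "smooth_fun M h"
  shows "grad M (\<lambda>p. a * g p + b * h p) = fscale (\<lambda>_. a) (grad M g) + fscale (\<lambda>_. b) (grad M h)"
proof
  fix p
  obtain c where c: "c \<in> charts_at M p" using ex_chart by blast
  let ?D = "\<lambda>h. frechet_derivative (h \<circ> chart_inv c) (at (snd c p))"
  have "((\<lambda>x. a *\<^sub>R (g \<circ> chart_inv c) x + b *\<^sub>R (h \<circ> chart_inv c) x) has_derivative
      (\<lambda>v. a *\<^sub>R ?D g v + b *\<^sub>R ?D h v)) (at (snd c p))"
    by (intro derivative_intros smooth_has_derivative g h c)
  from frechet_derivative_at[OF this]
  have D: "?D (\<lambda>p. a * g p + b * h p) v = a * ?D g v + b * ?D h v" for v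
    by (simp add: o_def fun_eq_iff)
  show "grad M (\<lambda>p. a * g p + b * h p) p = (fscale (\<lambda>_. a) (grad M g) + fscale (\<lambda>_. b) (grad M h)) p"
    by (rule grad_unique[OF smooth_fun_lincomb[OF g h]])
      (simp_all add: fscale_def tangent_add tangent_scale grad_mem g h gmet_add_left gmet_scale_left
        gmet_grad differential_chart[OF _ c] smooth_fun_lincomb D)
qed

lemma smooth_fun_zero: "smooth_fun M (\<lambda>_. 0)"
  by (simp add: smooth_fun_def smooth_on_zero o_def)

lemma grad_diff:
  assumes "smooth_fun M g" "smooth_fun M h"
  shows "grad M (\<lambda>p. g p - h p) = grad M g - grad M h"
proof -
  have "grad M (\<lambda>p. g p - h p) = fscale (\<lambda>_. 1) (grad M g) + fscale (\<lambda>_. -1) (grad M h)"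
    using grad_lincomb[OF assms, of 1 "-1"] by simp
  also have "\<dots> = grad M g - grad M h"
    by (intro ext) (simp add: fscale_def tscale_def)
  finally show ?thesis .
qed

lemma smooth_fun_continuous:
  assumes "smooth_fun M h"
  shows "continuous_on UNIV h"
proof (rule continuous_onI_charts)
  fix c assume c: "c \<in> atlas M"
  have "continuous_on (snd c ` fst c) (h \<circ> chart_inv c)"
    unfolding chart_image_def[symmetric]
    by (rule smooth_on_continuous) (use assms c in \<open>simp add: smooth_fun_def\<close>)
  from continuous_on_compose2[OF this continuous_chart[OF c] order_refl]
  show "continuous_on (fst c) h"
    by (simp add: chart_inv_chart[OF c] cong: continuous_on_cong)
qed

section \<open>Evaluation in the reproducing kernel space\<close>

lemma C1_continuous_field:
  assumes "v \<in> C1_vector_fields M"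
  shows "continuous_field v"
  unfolding continuous_field_def
proof (intro conjI ballI)
  show "v \<in> vector_fields M" using assms by (simp add: C1_vector_fields_def)
  fix c assume c: "c \<in> atlas M"
  have "Ck_on 1 (chart_image c) (\<lambda>x. v (chart_inv c x) c)"
    using assms c by (simp add: C1_vector_fields_def)
  then have "continuous_on (snd c ` fst c) (\<lambda>x. v (chart_inv c x) c)"
    unfolding chart_image_def[symmetric]
    by (auto intro!: continuous_at_imp_continuous_on differentiable_imp_continuous_within)
  from continuous_on_compose2[OF this continuous_chart[OF c] order_refl]
  show "continuous_on (fst c) (\<lambda>p. v p c)"
    by (simp add: chart_inv_chart[OF c] cong: continuous_on_cong)
qed

lemma rkhs_semi_inner:
  assumes "rkhs M k H ip"
  shows "semi_inner_space H (\<lambda>r. fscale (\<lambda>_. r)) ip"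
    and "semi_inner_space.complete H ip"
proof -
  note r = assms[unfolded rkhs_def]
  note zero = r[THEN conjunct2, THEN conjunct1]
  note add = r[THEN conjunct2, THEN conjunct2, THEN conjunct1, rule_format]
  note r' = r[THEN conjunct2, THEN conjunct2, THEN conjunct2]
  note sc = r'[THEN conjunct1, rule_format]
  note ip = r'[THEN conjunct2, THEN conjunct1, THEN bspec, THEN bspec, THEN bspec, THEN spec]
  note compl = r'[THEN conjunct2, THEN conjunct2, THEN conjunct1]
  have ip_sc: "ip (fscale (\<lambda>_. c) u) v = c * ip u v" if "u \<in> H" "v \<in> H" for c u v
    using ip[OF that zero, of c] by (elim conjE)
  have ip0: "ip 0 0 = 0"
  proof -
    have "fscale (\<lambda>_. 0) 0 = (0 :: ('a, 'n) vfield)"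
      by (intro ext) (simp add: fscale_def tscale_def)
    then show ?thesis using ip_sc[OF zero zero, of 0] by simp
  qed
  show semi: "semi_inner_space H (\<lambda>r. fscale (\<lambda>_. r)) ip"
  proof
    fix u v w :: "('a, 'n) vfield" and c :: real
    assume u: "u \<in> H"
    show "fscale (\<lambda>_. c) u \<in> H" by (rule sc[OF u])
    show "fscale (\<lambda>_. - 1) u = - u" by (rule fscale_minus1)
    have "u \<noteq> 0 \<longrightarrow> ip u u > 0" using ip[OF u zero zero, of c] by (elim conjE)
    then show "0 \<le> ip u u" using ip0 by (cases "u = 0") auto
    assume v: "v \<in> H"
    show "u + v \<in> H" by (rule add[OF u v])
    show "ip u v = ip v u" using ip[OF u v zero, of c] by (elim conjE)
    show "ip (fscale (\<lambda>_. c) u) v = c * ip u v" by (rule ip_sc[OF u v])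
    assume w: "w \<in> H"
    show "ip (u + w) v = ip u v + ip w v" using ip[OF u v w, of c] by (elim conjE)
  qed (rule zero)
  show "semi_inner_space.complete H ip"
    unfolding semi_inner_space.complete_def[OF semi] semi_inner_space.N_def[OF semi]
      Hnorm_def[symmetric]
    by (rule compl)
qed

lemma rkhs_definite: "rkhs M k H ip \<Longrightarrow> u \<in> H \<Longrightarrow> ip u u = 0 \<Longrightarrow> u = 0"
  unfolding rkhs_def by (elim conjE) (metis less_irrefl)

text \<open>Around \<open>p\<close> there is a compact coordinate ball, on which the \<open>C\<^sup>1\<close> estimate bounds the components of
a field and continuity bounds the Gram matrix.\<close>

lemma locally_bounded_evaluation:
  assumes C1: "continuously_in_C1 M H ip"
  shows "\<exists>U B. open U \<and> p \<in> U \<and> 0 \<le> B \<and>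
    (\<forall>v\<in>H. \<forall>q\<in>U. gmet M q (v q) (v q) \<le> B * (Hnorm ip v)\<^sup>2)"
proof -
  obtain c where cp: "c \<in> charts_at M p" using ex_chart by blast
  note c = charts_atD(1)[OF cp] and p = charts_atD(2)[OF cp]
  obtain e where e: "e > 0" "cball (snd c p) e \<subseteq> chart_image c"
    using open_contains_cball[of "chart_image c"] open_chart_image[OF c] chart_mem[OF c p] by blast
  let ?K = "chart_inv c ` cball (snd c p) e"
  let ?U = "fst c \<inter> snd c -` ball (snd c p) e"
  have K: "compact ?K" "?K \<subseteq> fst c"
    using e chart_inv_mem[OF c]
    by (auto intro!: compact_continuous_image continuous_on_subset[OF continuous_chart_inv[OF c]])
  have UK: "?U \<subseteq> ?K"
  proof
    fix q assume "q \<in> ?U"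
    then show "q \<in> ?K" using chart_inv_chart[OF c, of q] by (intro image_eqI[of _ _ "snd c q"]) auto
  qed
  obtain C where C: "\<And>v q. v \<in> H \<Longrightarrow> q \<in> ?K \<Longrightarrow> norm (v q c) \<le> C * Hnorm ip v"
    using C1[unfolded continuously_in_C1_def, THEN conjunct2, THEN bspec, OF c, THEN spec,
        THEN mp, OF conjI[OF K]] by blast
  define g where "g q = (\<Sum>i\<in>UNIV. \<Sum>j\<in>UNIV. \<bar>gram M c q $ i $ j\<bar>)" for q
  have "continuous_on ?K g"
    unfolding g_def by (intro continuous_intros continuous_on_subset[OF continuous_gram[OF c] K(2)])
  then have "bdd_above (g ` ?K)"
    by (intro bounded_imp_bdd_above compact_imp_bounded compact_continuous_image K(1))
  then obtain G where G: "\<And>q. q \<in> ?K \<Longrightarrow> g q \<le> G"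
    by (meson bdd_above.E imageI)
  have pU: "p \<in> ?U" using p e by simp
  have g0: "g q \<ge> 0" for q unfolding g_def by (intro sum_nonneg) auto
  have G0: "G \<ge> 0" using G[OF subsetD[OF UK pU]] g0[of p] by linarith
  have "gmet M q (v q) (v q) \<le> C\<^sup>2 * G * (Hnorm ip v)\<^sup>2" if v: "v \<in> H" and q: "q \<in> ?U" for v q
  proof -
    have cq: "c \<in> charts_at M q" using c q by (simp add: charts_at_def)
    have vq: "v q \<in> tangent_space M q"
      using C1 v unfolding continuously_in_C1_def C1_vector_fields_def vector_fields_def by blast
    have qK: "q \<in> ?K" using UK q by blast
    have "gmet M q (v q) (v q) = (\<Sum>i\<in>UNIV. \<Sum>j\<in>UNIV. v q c $ i * v q c $ j * gram M c q $ i $ j)"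
      by (rule gmet_coord[OF cq vq vq])
    also have "\<dots> \<le> (\<Sum>i\<in>UNIV. \<Sum>j\<in>UNIV. (norm (v q c))\<^sup>2 * \<bar>gram M c q $ i $ j\<bar>)"
    proof (intro sum_mono)
      fix i j
      have "v q c $ i * v q c $ j * gram M c q $ i $ j
          \<le> \<bar>v q c $ i\<bar> * \<bar>v q c $ j\<bar> * \<bar>gram M c q $ i $ j\<bar>"
        unfolding abs_mult[symmetric] by (rule abs_ge_self)
      also have "\<dots> \<le> norm (v q c) * norm (v q c) * \<bar>gram M c q $ i $ j\<bar>"
        by (intro mult_right_mono mult_mono component_le_norm_cart) auto
      finally show "v q c $ i * v q c $ j * gram M c q $ i $ j
          \<le> (norm (v q c))\<^sup>2 * \<bar>gram M c q $ i $ j\<bar>"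
        by (simp add: power2_eq_square)
    qed
    also have "\<dots> = (norm (v q c))\<^sup>2 * g q"
      unfolding g_def by (simp only: sum_distrib_left)
    also have "\<dots> \<le> (C * Hnorm ip v)\<^sup>2 * G"
      by (intro mult_mono power_mono C[OF v qK] G[OF qK] g0) auto
    finally show ?thesis by (simp add: power_mult_distrib mult_ac)
  qed
  moreover have "open ?U"
    by (intro continuous_open_preimage continuous_chart open_chart c open_ball)
  ultimately show ?thesis
    using pU G0 by (intro exI[of _ ?U] exI[of _ "C\<^sup>2 * G"]) auto
qed

lemma bounded_evaluation:
  assumes C1: "continuously_in_C1 M H ip"
  shows "\<exists>B. \<forall>v\<in>H. \<forall>p. gmet M p (v p) (v p) \<le> B * (Hnorm ip v)\<^sup>2"
proof -
  have "\<forall>p. \<exists>U B. open U \<and> p \<in> U \<and> 0 \<le> B \<and>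
      (\<forall>v\<in>H. \<forall>q\<in>U. gmet M q (v q) (v q) \<le> B * (Hnorm ip v)\<^sup>2)"
    using locally_bounded_evaluation[OF C1] by blast
  then obtain U B where U: "\<And>p. open (U p)" "\<And>p. p \<in> U p" "\<And>p. 0 \<le> (B p :: real)"
    and bound: "\<And>p v q. v \<in> H \<Longrightarrow> q \<in> U p \<Longrightarrow> gmet M q (v q) (v q) \<le> B p * (Hnorm ip v)\<^sup>2"
    by metis
  have cover: "UNIV \<subseteq> (\<Union>p\<in>UNIV. U p)" using U(2) by blast
  obtain A where A: "A \<subseteq> UNIV" "finite A" "UNIV \<subseteq> (\<Union>p\<in>A. U p)"
    by (rule compactE_image[OF compact_manifold U(1) cover])
  have "gmet M q (v q) (v q) \<le> sum B A * (Hnorm ip v)\<^sup>2" if v: "v \<in> H" for v q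
  proof -
    obtain p where p: "p \<in> A" "q \<in> U p" using A(3) by blast
    have "gmet M q (v q) (v q) \<le> B p * (Hnorm ip v)\<^sup>2" by (rule bound[OF v p(2)])
    also have "\<dots> \<le> sum B A * (Hnorm ip v)\<^sup>2"
      using member_le_sum[OF p(1) U(3) A(2)] by (intro mult_right_mono) auto
    finally show ?thesis .
  qed
  then show ?thesis by blast
qed

end

section \<open>The Hilbert space of square integrable vector fields\<close>

text \<open>The weight is a parameter because two weights occur: the density, and the constant \<open>1\<close> in the
definition of Sobolev functions.\<close>

locale weighted_manifold = closed_riemannian M
  for M :: "('a::{t2_space, second_countable_topology}, 'n::finite) riem" +
  fixes \<sigma> :: "'a \<Rightarrow> real"
  assumes weight_pos: "\<sigma> p > 0"
    and weight_cont: "continuous_on UNIV \<sigma>"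
    and finite_volume: "finite_measure (dvol M)"
begin

lemma continuous_measurable: "continuous_on UNIV \<phi> \<Longrightarrow> \<phi> \<in> borel_measurable (dvol M)"
  by (simp add: measurable_volume borel_measurable_continuous_onI)

lemma continuous_integrable:
  fixes \<phi> :: "'a \<Rightarrow> real"
  assumes "continuous_on UNIV \<phi>"
  shows "integrable (dvol M) \<phi>"
proof -
  have "bounded (range \<phi>)"
    by (intro compact_imp_bounded compact_continuous_image assms compact_manifold)
  then obtain B where B: "\<And>p. norm (\<phi> p) \<le> B" by (auto simp: bounded_iff)
  show ?thesis
    by (rule finite_measure.integrable_const_bound[OF finite_volume, of _ B])
      (simp_all add: B[unfolded real_norm_def] continuous_measurable assms)
qed

lemma L2_vfI:
  "v \<in> vector_fields M \<Longrightarrow> (\<And>c. c \<in> atlas M \<Longrightarrow> (\<lambda>p. v p c) \<in> borel_measurable borel) \<Longrightarrow>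
    integrable (dvol M) (\<lambda>p. gmet M p (v p) (v p) * \<sigma> p) \<Longrightarrow> v \<in> L2_vf M \<sigma>"
  by (simp add: L2_vf_def)

lemma
  assumes "v \<in> L2_vf M \<sigma>"
  shows L2_vf_field: "v \<in> vector_fields M"
    and L2_vf_tangent: "v p \<in> tangent_space M p"
    and L2_vf_measurable: "c \<in> atlas M \<Longrightarrow> (\<lambda>p. v p c) \<in> borel_measurable borel"
    and L2_vf_integrable: "integrable (dvol M) (\<lambda>p. gmet M p (v p) (v p) * \<sigma> p)"
  using assms by (simp_all add: L2_vf_def vector_fields_def)

lemma weighted_gmet_measurable:
  assumes "u \<in> vector_fields M" "\<And>c. c \<in> atlas M \<Longrightarrow> (\<lambda>p. u p c) \<in> borel_measurable borel"
    and "v \<in> vector_fields M" "\<And>c. c \<in> atlas M \<Longrightarrow> (\<lambda>p. v p c) \<in> borel_measurable borel"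
  shows "(\<lambda>p. gmet M p (u p) (v p) * \<sigma> p) \<in> borel_measurable (dvol M)"
  unfolding measurable_volume
  by (intro borel_measurable_times measurable_gmet assms borel_measurable_continuous_onI[OF weight_cont])

lemma integrable_inner:
  assumes u: "u \<in> L2_vf M \<sigma>" and v: "v \<in> L2_vf M \<sigma>"
  shows "integrable (dvol M) (\<lambda>p. gmet M p (u p) (v p) * \<sigma> p)"
proof (rule Bochner_Integration.integrable_bound)
  show "integrable (dvol M) (\<lambda>p. gmet M p (u p) (u p) * \<sigma> p + gmet M p (v p) (v p) * \<sigma> p)"
    by (intro Bochner_Integration.integrable_add L2_vf_integrable u v)
  show "(\<lambda>p. gmet M p (u p) (v p) * \<sigma> p) \<in> borel_measurable (dvol M)"
    using u v by (intro weighted_gmet_measurable L2_vf_field L2_vf_measurable)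
  show "AE p in dvol M. norm (gmet M p (u p) (v p) * \<sigma> p)
      \<le> norm (gmet M p (u p) (u p) * \<sigma> p + gmet M p (v p) (v p) * \<sigma> p)"
  proof (rule AE_I2)
    fix p
    note t = L2_vf_tangent[OF u, of p] L2_vf_tangent[OF v, of p]
    have "\<bar>gmet M p (u p) (v p)\<bar> * \<sigma> p \<le> (gmet M p (u p) (u p) + gmet M p (v p) (v p)) * \<sigma> p"
      using abs_gmet_le[OF t] weight_pos[of p] by (intro mult_right_mono) auto
    then show "norm (gmet M p (u p) (v p) * \<sigma> p)
      \<le> norm (gmet M p (u p) (u p) * \<sigma> p + gmet M p (v p) (v p) * \<sigma> p)"
      using weight_pos[of p] gmet_nonneg[OF t(1)] gmet_nonneg[OF t(2)]
      by (simp add: abs_mult distrib_right)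
  qed
qed

lemma L2_vf_add:
  assumes u: "u \<in> L2_vf M \<sigma>" and v: "v \<in> L2_vf M \<sigma>"
  shows "u + v \<in> L2_vf M \<sigma>"
proof (rule L2_vfI)
  show "u + v \<in> vector_fields M" by (intro vector_fields_add L2_vf_field u v)
  show "(\<lambda>p. (u + v) p c) \<in> borel_measurable borel" if "c \<in> atlas M" for c
    unfolding plus_fun_apply using L2_vf_measurable[OF u that] L2_vf_measurable[OF v that]
    by (rule borel_measurable_add)
  have "gmet M p ((u + v) p) ((u + v) p) * \<sigma> p = gmet M p (u p) (u p) * \<sigma> p
      + 2 * (gmet M p (u p) (v p) * \<sigma> p) + gmet M p (v p) (v p) * \<sigma> p" for p
  proof -
    interpret T: semi_inner_space "tangent_space M p" tscale "gmet M p" by (rule tangent_semi_inner)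
    show ?thesis
      using L2_vf_tangent[OF u, of p] L2_vf_tangent[OF v, of p]
      by (simp add: T.add_left T.add_right T.add_mem T.sym[of "v p" "u p"] algebra_simps)
  qed
  then show "integrable (dvol M) (\<lambda>p. gmet M p ((u + v) p) ((u + v) p) * \<sigma> p)"
    by (simp add: L2_vf_integrable integrable_inner u v)
qed

lemma L2_vf_fscale:
  assumes u: "u \<in> L2_vf M \<sigma>"
  shows "fscale (\<lambda>_. r) u \<in> L2_vf M \<sigma>"
proof (rule L2_vfI)
  show "fscale (\<lambda>_. r) u \<in> vector_fields M" by (intro vector_fields_fscale L2_vf_field u)
  show "(\<lambda>p. fscale (\<lambda>_. r) u p c) \<in> borel_measurable borel" if "c \<in> atlas M" for c
    using L2_vf_measurable[OF u that] by (simp add: fscale_def tscale_def)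
  have eq: "gmet M p (fscale (\<lambda>_. r) u p) (fscale (\<lambda>_. r) u p) * \<sigma> p
      = r * r * (gmet M p (u p) (u p) * \<sigma> p)" for p
  proof -
    interpret T: semi_inner_space "tangent_space M p" tscale "gmet M p" by (rule tangent_semi_inner)
    show ?thesis
      using L2_vf_tangent[OF u, of p] by (simp add: fscale_def T.sc_left T.sc_right T.sc_mem)
  qed
  show "integrable (dvol M) (\<lambda>p. gmet M p (fscale (\<lambda>_. r) u p) (fscale (\<lambda>_. r) u p) * \<sigma> p)"
    unfolding eq by (intro integrable_mult_right L2_vf_integrable u)
qed

lemma L2_vf_zero: "0 \<in> L2_vf M \<sigma>"
  by (rule L2_vfI) (simp_all add: vector_fields_zero gmet_zero_left tangent_zero)

sublocale L2: semi_inner_space "L2_vf M \<sigma>" "\<lambda>r. fscale (\<lambda>_. r)" "L2_inner M \<sigma>"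
proof
  fix u v w :: "('a, 'n) vfield" and r :: real
  assume u: "u \<in> L2_vf M \<sigma>"
  show "fscale (\<lambda>_. r) u \<in> L2_vf M \<sigma>" by (rule L2_vf_fscale[OF u])
  show "fscale (\<lambda>_. - 1) u = - u" by (rule fscale_minus1)
  show "0 \<le> L2_inner M \<sigma> u u"
    unfolding L2_inner_def using gmet_nonneg[OF L2_vf_tangent[OF u]] weight_pos
    by (intro Bochner_Integration.integral_nonneg) (simp add: less_imp_le)
  assume v: "v \<in> L2_vf M \<sigma>"
  show "u + v \<in> L2_vf M \<sigma>" by (rule L2_vf_add[OF u v])
  show "L2_inner M \<sigma> u v = L2_inner M \<sigma> v u"
    unfolding L2_inner_def using L2_vf_tangent[OF u] L2_vf_tangent[OF v]
    by (simp add: gmet_sym[of "u _"])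
  show "L2_inner M \<sigma> (fscale (\<lambda>_. r) u) v = r * L2_inner M \<sigma> u v"
    unfolding L2_inner_def using L2_vf_tangent[OF u] L2_vf_tangent[OF v]
    by (simp add: fscale_def gmet_scale_left mult.assoc)
  assume w: "w \<in> L2_vf M \<sigma>"
  have "gmet M p ((u + w) p) (v p) * \<sigma> p = gmet M p (u p) (v p) * \<sigma> p + gmet M p (w p) (v p) * \<sigma> p" for p
    using L2_vf_tangent[OF u] L2_vf_tangent[OF v] L2_vf_tangent[OF w]
    by (simp add: gmet_add_left distrib_right)
  then show "L2_inner M \<sigma> (u + w) v = L2_inner M \<sigma> u v + L2_inner M \<sigma> w v"
    unfolding L2_inner_def by (simp add: integrable_inner u v w)
qed (rule L2_vf_zero)

lemma L2_norm_eq: "L2_norm M \<sigma> = L2.N"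
  by (rule ext) (simp add: L2_norm_def L2.N_def)

lemma continuous_field_L2:
  assumes "continuous_field v"
  shows "v \<in> L2_vf M \<sigma>"
  by (rule L2_vfI)
    (use assms in \<open>auto simp: continuous_field_def intro!: continuous_field_measurable
      continuous_integrable continuous_intros continuous_gmet weight_cont\<close>)

lemma L2_norm_eq_0_iff:
  assumes u: "u \<in> L2_vf M \<sigma>"
  shows "L2_norm M \<sigma> u = 0 \<longleftrightarrow> L2_eq M u 0"
proof -
  have nn: "AE p in dvol M. 0 \<le> gmet M p (u p) (u p) * \<sigma> p"
    using gmet_nonneg[OF L2_vf_tangent[OF u]] weight_pos by (simp add: less_imp_le)
  have "gmet M p (u p) (u p) * \<sigma> p = 0 \<longleftrightarrow> u p = 0" for p
    using gmet_pos[OF L2_vf_tangent[OF u], of p] gmet_zero_left[OF tangent_zero, of p]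
      weight_pos[of p] by (cases "u p = 0") auto
  then show ?thesis
    using integral_nonneg_eq_0_iff_AE[OF L2_vf_integrable[OF u] nn]
    by (simp add: L2_norm_def L2_inner_def L2_eq_def)
qed

lemma L2_eq_iff:
  assumes "u \<in> L2_vf M \<sigma>" "v \<in> L2_vf M \<sigma>"
  shows "L2_eq M u v \<longleftrightarrow> L2_norm M \<sigma> (u - v) = 0"
  using L2_norm_eq_0_iff[OF L2.diff_mem[OF assms]] by (simp add: L2_eq_def)

section \<open>Completeness\<close>

text \<open>The Riesz-Fischer argument. With \<open>d n\<close> the pointwise length of the \<open>n\<close>-th increment, the functions
\<open>2 ^ n * (d n)\<^sup>2\<close> have summable integrals, so they are summable almost everywhere; since
\<open>x \<le> 2 ^ n * x\<^sup>2 + (1/2) ^ n\<close>, so are the lengths themselves. Thus the sequence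
converges almost everywhere in each tangent space, and Fatou's lemma bounds the distances to the limit.\<close>

lemma fast_cauchy_limit:
  assumes t: "\<And>n. t n \<in> L2_vf M \<sigma>"
    and fast: "\<And>m n. n \<le> m \<Longrightarrow> (L2_norm M \<sigma> (t m - t n))\<^sup>2 \<le> (1/4) ^ n"
  shows "\<exists>V\<in>L2_vf M \<sigma>. \<forall>m. (L2_norm M \<sigma> (V - t m))\<^sup>2 \<le> (1/4) ^ m"
proof -
  note tT = L2_vf_tangent[OF t]
  let ?g = "\<lambda>p \<xi>. gmet M p \<xi> \<xi>"
  have diffL2: "t m - t n \<in> L2_vf M \<sigma>" for m n by (intro L2.diff_mem t)
  have diffT: "t m p - t n p \<in> tangent_space M p" for m n p by (intro tangent_diff tT)
  define f where "f n = (\<lambda>p. 2 ^ n * (?g p (t (Suc n) p - t n p) * \<sigma> p))" for n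
  have f_nonneg: "f n p \<ge> 0" for n p
    unfolding f_def using gmet_nonneg[OF diffT] weight_pos by (simp add: less_imp_le)
  have f_int: "integrable (dvol M) (f n)" for n
    unfolding f_def using L2_vf_integrable[OF diffL2] by simp
  note f_meas[measurable] = borel_measurable_integrable[OF f_int]
  have f_small: "integral\<^sup>L (dvol M) (f n) \<le> (1/2) ^ n" for n
  proof -
    have "integral\<^sup>L (dvol M) (f n) = 2 ^ n * (L2_norm M \<sigma> (t (Suc n) - t n))\<^sup>2"
      unfolding L2_norm_eq L2.N_squared[OF diffL2] by (simp add: f_def L2_inner_def)
    also have "\<dots> \<le> 2 ^ n * (1/4) ^ n" by (intro mult_left_mono fast) auto
    also have "\<dots> = (1/2) ^ n" by (simp flip: power_mult_distrib)
    finally show ?thesis .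
  qed
  \<comment> \<open>a set of full measure on which the sequence converges; zero elsewhere keeps the limit measurable and tangent\<close>
  define E where "E = {p. (\<Sum>n. ennreal (f n p)) \<noteq> top}"
  have "(\<integral>\<^sup>+p. (\<Sum>n. ennreal (f n p)) \<partial>dvol M) = (\<Sum>n. \<integral>\<^sup>+p. ennreal (f n p) \<partial>dvol M)"
    by (intro nn_integral_suminf) simp
  also have "\<dots> \<le> (\<Sum>n. ennreal ((1/2) ^ n))"
    using f_small
    by (intro suminf_le) (simp_all add: nn_integral_eq_integral f_int f_nonneg ennreal_leI)
  also have "\<dots> = ennreal (\<Sum>n. (1/2) ^ n)"
    by (intro suminf_ennreal2) (simp_all add: summable_geometric)
  finally have "(\<integral>\<^sup>+p. (\<Sum>n. ennreal (f n p)) \<partial>dvol M) \<noteq> \<infinity>"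
    by (auto simp: top_unique)
  then have AE_E: "AE p in dvol M. p \<in> E"
    using nn_integral_PInf_AE[of "\<lambda>p. \<Sum>n. ennreal (f n p)" "dvol M"] by (simp add: E_def)
  have E_sets: "E \<in> sets borel"
  proof -
    have "{p\<in>space (dvol M). (\<Sum>n. ennreal (f n p)) \<noteq> top} \<in> sets (dvol M)" by measurable
    then show ?thesis by (simp add: E_def space_volume sets_volume)
  qed
  define V where "V p = (\<lambda>c. if p \<in> E then lim (\<lambda>n. t n p c) else 0)" for p
  have lim_chart: "(\<lambda>n. t n p c) \<longlonglongrightarrow> V p c" if p: "p \<in> E" and c: "c \<in> charts_at M p" for p c
  proof -
    obtain C where C: "\<And>\<xi>. \<xi> \<in> tangent_space M p \<Longrightarrow> norm (\<xi> c) \<le> C * sqrt (?g p \<xi>)"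
      using coordinates_bounded_by_metric[OF c] by blast
    have sf: "summable (\<lambda>n. f n p)"
      using p f_nonneg by (intro summable_suminf_not_top) (auto simp: E_def)
    \<comment> \<open>\<open>0 \<le> (2 ^ n * x - 1)\<^sup>2 + 2 ^ n * x\<close>, divided by \<open>2 ^ n\<close>\<close>
    have bound: "sqrt (?g p (t (Suc n) p - t n p)) \<le> f n p / \<sigma> p + (1/2) ^ n" (is "?x \<le> _") for n
    proof -
      have "0 \<le> (2 ^ n * ?x - 1)\<^sup>2 + 2 ^ n * ?x"
        using gmet_nonneg[OF diffT] by simp
      then have "?x * 2 ^ n \<le> (2 ^ n)\<^sup>2 * ?x\<^sup>2 + 1"
        by (simp add: power2_diff power_mult_distrib algebra_simps)
      then have "?x \<le> 2 ^ n * ?x\<^sup>2 + (1/2) ^ n"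
        by (simp add: field_simps power2_eq_square power_one_over)
      then show ?thesis
        using gmet_nonneg[OF diffT] weight_pos[of p] by (simp add: f_def)
    qed
    have "summable (\<lambda>n. f n p / \<sigma> p + (1/2) ^ n)"
      by (intro summable_add summable_divide sf summable_geometric) simp
    then have "summable (\<lambda>n. sqrt (?g p (t (Suc n) p - t n p)))"
      by (rule summable_comparison_test'[where N = 0])
        (simp only: real_norm_def abs_of_nonneg[OF real_sqrt_ge_zero[OF gmet_nonneg[OF diffT]]] bound)
    then have "summable (\<lambda>n. C * sqrt (?g p (t (Suc n) p - t n p)))"
      by (rule summable_mult)
    then have "summable (\<lambda>n. t (Suc n) p c - t n p c)"
      by (rule summable_comparison_test'[where N = 0]) (use C[OF diffT] in simp)
    then have "convergent (\<lambda>n. \<Sum>k<n. t (Suc k) p c - t k p c)"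
      by (simp add: summable_iff_convergent)
    then have "convergent (\<lambda>n. t n p c - t 0 p c)"
      by (simp only: sum_lessThan_telescope[of "\<lambda>n. t n p c"])
    then have "convergent (\<lambda>n. t n p c)"
      by (simp add: convergent_diff_const_right_iff)
    then show ?thesis using p by (simp add: V_def convergent_LIMSEQ_iff)
  qed
  have lim_V: "(\<lambda>n. t n p c) \<longlonglongrightarrow> V p c" if p: "p \<in> E" for p c
    using lim_chart[OF p] tangent_outside[OF tT] p
    by (cases "c \<in> charts_at M p") (simp_all add: V_def)
  have VT: "V p \<in> tangent_space M p" for p
  proof (cases "p \<in> E")
    case True
    show ?thesis
    proof (rule tangentI)
      fix c d assume cd: "c \<in> charts_at M p" "d \<in> charts_at M p"
      have "(\<lambda>n. transition_deriv c d p (t n p c)) \<longlonglongrightarrow> transition_deriv c d p (V p c)"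
        using transition_deriv_linear[OF cd] linear_conv_bounded_linear
        by (intro bounded_linear.tendsto[of "transition_deriv c d p"] lim_V True) auto
      then show "transition_deriv c d p (V p c) = V p d"
        using lim_V[OF True, of d] by (simp add: tangent_transform[OF tT cd] LIMSEQ_unique)
    next
      fix c assume "c \<notin> charts_at M p"
      then show "V p c = 0" using True tangent_outside[OF tT] by (simp add: V_def)
    qed
  next
    case False
    then have "V p = 0" by (auto simp: V_def)
    then show ?thesis by (simp add: tangent_zero)
  qed
  have V_field: "V \<in> vector_fields M" by (simp add: vector_fields_def VT)
  have V_meas: "(\<lambda>p. V p c) \<in> borel_measurable borel" if "c \<in> atlas M" for c
  proof -
    have [measurable]: "(\<lambda>p. t n p c) \<in> borel_measurable borel" for n
      by (rule L2_vf_measurable[OF t that])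
    show ?thesis unfolding V_def by (intro measurable_If_set borel_measurable_lim_metric) (use E_sets in auto)
  qed
  have Vm_field: "V - t m \<in> vector_fields M" for m
    by (intro vector_fields_diff V_field L2_vf_field t)
  have Vm_meas: "(\<lambda>p. (V - t m) p c) \<in> borel_measurable borel" if "c \<in> atlas M" for c m
    using V_meas[OF that] L2_vf_measurable[OF t that] by simp
  have lim_g: "(\<lambda>n. ?g p (t n p - t m p)) \<longlonglongrightarrow> ?g p (V p - t m p)" if p: "p \<in> E" for p m
  proof -
    obtain c where c: "c \<in> charts_at M p" using ex_chart by blast
    show ?thesis
      unfolding gmet_coord[OF c diffT diffT]
        gmet_coord[OF c tangent_diff[OF VT tT] tangent_diff[OF VT tT]] minus_apply
      by (intro tendsto_intros lim_V p)
  qed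
  have small: "(\<integral>\<^sup>+p. ennreal (?g p (V p - t m p) * \<sigma> p) \<partial>dvol M) \<le> ennreal ((1/4) ^ m)" for m
  proof -
    let ?h = "\<lambda>n p. ennreal (?g p (t n p - t m p) * \<sigma> p)"
    have "(\<integral>\<^sup>+p. ennreal (?g p (V p - t m p) * \<sigma> p) \<partial>dvol M)
        = (\<integral>\<^sup>+p. liminf (\<lambda>n. ?h n p) \<partial>dvol M)"
    proof (rule nn_integral_cong_AE)
      show "AE p in dvol M. ennreal (?g p (V p - t m p) * \<sigma> p) = liminf (\<lambda>n. ?h n p)"
        using AE_E
      proof eventually_elim
        case (elim p)
        have "(\<lambda>n. ?h n p) \<longlonglongrightarrow> ennreal (?g p (V p - t m p) * \<sigma> p)"
          by (intro tendsto_ennrealI tendsto_intros lim_g elim)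
        then show ?case by (simp add: lim_imp_Liminf)
      qed
    qed
    also have "\<dots> \<le> liminf (\<lambda>n. \<integral>\<^sup>+p. ?h n p \<partial>dvol M)"
      using borel_measurable_integrable[OF L2_vf_integrable[OF diffL2]]
      by (intro nn_integral_liminf) simp
    also have "\<dots> \<le> ennreal ((1/4) ^ m)"
    proof (rule Liminf_le)
      show "\<forall>\<^sub>F n in sequentially. (\<integral>\<^sup>+p. ?h n p \<partial>dvol M) \<le> ennreal ((1/4) ^ m)"
        using eventually_ge_at_top[of m]
      proof eventually_elim
        case (elim n)
        have "(\<integral>\<^sup>+p. ?h n p \<partial>dvol M) = ennreal (L2_inner M \<sigma> (t n - t m) (t n - t m))"
          unfolding L2_inner_def
          using L2_vf_integrable[OF diffL2, of n m] gmet_nonneg[OF diffT] weight_pos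
          by (subst nn_integral_eq_integral) (simp_all add: less_imp_le)
        also have "\<dots> \<le> ennreal ((1/4) ^ m)"
          using fast[OF elim] unfolding L2_norm_eq L2.N_squared[OF diffL2] by (rule ennreal_leI)
        finally show ?case .
      qed
    qed simp
    finally show ?thesis .
  qed
  have Vm_meas': "(\<lambda>p. ?g p ((V - t m) p) * \<sigma> p) \<in> borel_measurable (dvol M)" for m
    by (intro weighted_gmet_measurable Vm_field Vm_meas)
  have Vm_nonneg: "0 \<le> ?g p ((V - t m) p) * \<sigma> p" for p m
    using gmet_nonneg[OF tangent_diff[OF VT tT]] weight_pos by (simp add: less_imp_le)
  have Vm_int: "integrable (dvol M) (\<lambda>p. ?g p ((V - t m) p) * \<sigma> p)" for m
  proof (rule integrableI_nonneg)
    show "(\<integral>\<^sup>+p. ennreal (?g p ((V - t m) p) * \<sigma> p) \<partial>dvol M) < \<infinity>"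
      using small[of m] by (simp add: le_less_trans[OF _ ennreal_less_top])
  qed (use Vm_meas' Vm_nonneg in auto)
  have Vm: "V - t m \<in> L2_vf M \<sigma>" for m
    by (intro L2_vfI Vm_field Vm_meas Vm_int)
  have "(L2_norm M \<sigma> (V - t m))\<^sup>2 \<le> (1/4) ^ m" for m
  proof -
    have "ennreal (L2_inner M \<sigma> (V - t m) (V - t m)) \<le> ennreal ((1/4) ^ m)"
      using small[of m] nn_integral_eq_integral[OF Vm_int AE_I2[OF Vm_nonneg], of m]
      by (simp add: L2_inner_def)
    then show ?thesis
      unfolding L2_norm_eq L2.N_squared[OF Vm] by simp
  qed
  moreover have "V \<in> L2_vf M \<sigma>"
    using L2.add_mem[OF Vm[of 0] t[of 0]] by simp
  ultimately show ?thesis by blast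
qed

text \<open>A Cauchy sequence has a subsequence that satisfies the hypotheses of the previous lemma. Its indices
are maxima of the Cauchy bounds, so they need only be weakly increasing.\<close>

theorem L2_complete: L2.complete
  unfolding L2.complete_def
proof (intro allI impI, elim conjE)
  fix s :: "nat \<Rightarrow> ('a, 'n) vfield"
  assume s': "\<forall>n. s n \<in> L2_vf M \<sigma>"
    and cauchy: "\<forall>\<epsilon>>0. \<exists>K. \<forall>m\<ge>K. \<forall>n\<ge>K. L2.N (s m - s n) < \<epsilon>"
  have s: "s n \<in> L2_vf M \<sigma>" for n using s' by blast
  have "\<forall>k. \<exists>K. \<forall>m\<ge>K. \<forall>n\<ge>K. L2.N (s m - s n) < (1/2) ^ k"
    using cauchy by simp
  then obtain K where K: "\<And>k m n. m \<ge> K k \<Longrightarrow> n \<ge> K k \<Longrightarrow> L2.N (s m - s n) < (1/2) ^ k"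
    by metis
  define r where "r n = Max (K ` {..n})" for n
  have r_ge: "K n \<le> r m" if "n \<le> m" for n m
    unfolding r_def using that by (intro Max_ge) auto
  have "(L2_norm M \<sigma> (s (r m) - s (r n)))\<^sup>2 \<le> (1/4) ^ n" if "n \<le> m" for m n
  proof -
    have "L2.N (s (r m) - s (r n)) \<le> (1/2) ^ n"
      using K[OF r_ge[OF that] r_ge[OF order_refl, of n]] by simp
    then have "(L2.N (s (r m) - s (r n)))\<^sup>2 \<le> ((1/2) ^ n)\<^sup>2"
      by (intro power_mono L2.N_nonneg L2.diff_mem s)
    then show ?thesis by (simp add: L2_norm_eq power2_eq_square flip: power_mult_distrib)
  qed
  then obtain V where V: "V \<in> L2_vf M \<sigma>" "\<And>m. (L2_norm M \<sigma> (V - s (r m)))\<^sup>2 \<le> (1/4) ^ m"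
    using fast_cauchy_limit[of "\<lambda>n. s (r n)"] s by blast
  have "(\<lambda>n. L2.N (s n - V)) \<longlonglongrightarrow> 0"
  proof (rule LIMSEQ_I)
    fix e :: real assume "e > 0"
    then obtain k where k: "(1/2) ^ k < e / 2"
      using real_arch_pow_inv[of "e / 2" "1/2"] by auto
    have "norm (L2.N (s n - V) - 0) < e" if "n \<ge> K k" for n
    proof -
      have sq: "((1/2::real) ^ k)\<^sup>2 = (1/4) ^ k"
        by (simp add: power2_eq_square flip: power_mult_distrib)
      have "L2.N (s n - V) \<le> L2.N (s n - s (r k)) + L2.N (s (r k) - V)"
        using L2.triangle[OF L2.diff_mem[OF s s] L2.diff_mem[OF s V(1)], of n "r k" "r k"] by simp
      moreover have "L2.N (s n - s (r k)) < e / 2"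
        using K[OF that r_ge[OF order_refl]] k by linarith
      moreover have "L2.N (s (r k) - V) \<le> (1/2) ^ k"
        unfolding L2.N_minus_commute[OF s V(1)]
        by (rule power2_le_imp_le) (use V(2)[of k] sq in \<open>auto simp: L2_norm_eq\<close>)
      ultimately show ?thesis
        using k L2.N_nonneg[OF L2.diff_mem[OF s V(1)], of n] by simp
    qed
    then show "\<exists>no. \<forall>n\<ge>no. norm (L2.N (s n - V) - 0) < e" by blast
  qed
  then show "\<exists>v\<in>L2_vf M \<sigma>. (\<lambda>n. L2.N (s n - v)) \<longlonglongrightarrow> 0" using V(1) by blast
qed

section \<open>Horizontal fields\<close>

lemma grad_L2: "smooth_fun M h \<Longrightarrow> grad M h \<in> L2_vf M \<sigma>"
  by (intro continuous_field_L2 continuous_field_grad)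

lemma horizontal_L2: "v \<in> horizontal M \<sigma> \<Longrightarrow> v \<in> L2_vf M \<sigma>"
  by (simp add: horizontal_def)

lemma horizontal_approx:
  assumes "v \<in> horizontal M \<sigma>" "\<epsilon> > 0"
  obtains h where "smooth_fun M h" "L2_norm M \<sigma> (v - grad M h) < \<epsilon>"
  using assms by (auto simp: horizontal_def)

lemma horizontalI:
  "v \<in> L2_vf M \<sigma> \<Longrightarrow> (\<And>\<epsilon>. \<epsilon> > 0 \<Longrightarrow> \<exists>h. smooth_fun M h \<and> L2_norm M \<sigma> (v - grad M h) < \<epsilon>) \<Longrightarrow>
    v \<in> horizontal M \<sigma>"
  by (simp add: horizontal_def)

lemma grad_horizontal: "smooth_fun M h \<Longrightarrow> grad M h \<in> horizontal M \<sigma>"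
  by (rule horizontalI) (auto simp: grad_L2 L2_norm_eq_0_iff[THEN iffD2] L2_vf_zero L2_eq_def)

lemma horizontal_closed:
  assumes v: "v \<in> L2_vf M \<sigma>"
    and appr: "\<And>\<epsilon>. \<epsilon> > 0 \<Longrightarrow> \<exists>w\<in>horizontal M \<sigma>. L2_norm M \<sigma> (v - w) < \<epsilon>"
  shows "v \<in> horizontal M \<sigma>"
proof (rule horizontalI[OF v])
  fix \<epsilon> :: real assume "\<epsilon> > 0"
  then obtain w where w: "w \<in> horizontal M \<sigma>" "L2_norm M \<sigma> (v - w) < \<epsilon> / 2"
    using appr[of "\<epsilon> / 2"] by auto
  obtain h where h: "smooth_fun M h" "L2_norm M \<sigma> (w - grad M h) < \<epsilon> / 2"
    using horizontal_approx[OF w(1), of "\<epsilon> / 2"] \<open>\<epsilon> > 0\<close> by auto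
  have "L2_norm M \<sigma> (v - grad M h) < \<epsilon>"
    using L2.triangle[of "v - w" "w - grad M h"] w h v
    by (simp add: L2_norm_eq L2.diff_mem horizontal_L2 grad_L2)
  then show "\<exists>h. smooth_fun M h \<and> L2_norm M \<sigma> (v - grad M h) < \<epsilon>" using h(1) by blast
qed

text \<open>The closure of a linear space is linear, because the gradient is linear.\<close>

lemma horizontal_lincomb:
  assumes u: "u \<in> horizontal M \<sigma>" and v: "v \<in> horizontal M \<sigma>"
  shows "fscale (\<lambda>_. a) u + fscale (\<lambda>_. b) v \<in> horizontal M \<sigma>" (is "?s u v \<in> _")
proof (rule horizontalI)
  note L2 = horizontal_L2[OF u] horizontal_L2[OF v]
  show "?s u v \<in> L2_vf M \<sigma>" by (intro L2.add_mem L2.sc_mem L2)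
  fix \<epsilon> :: real assume e: "\<epsilon> > 0"
  \<comment> \<open>the summand \<open>1\<close> keeps the denominator positive when both coefficients vanish\<close>
  define \<delta> where "\<delta> = \<epsilon> / (\<bar>a\<bar> + \<bar>b\<bar> + 1)"
  have \<delta>: "\<delta> > 0" unfolding \<delta>_def using e by (intro divide_pos_pos) auto
  obtain g where g: "smooth_fun M g" "L2_norm M \<sigma> (u - grad M g) < \<delta>"
    using horizontal_approx[OF u \<delta>] .
  obtain h where h: "smooth_fun M h" "L2_norm M \<sigma> (v - grad M h) < \<delta>"
    using horizontal_approx[OF v \<delta>] .
  let ?k = "\<lambda>p. a * g p + b * h p"
  have L2': "u - grad M g \<in> L2_vf M \<sigma>" "v - grad M h \<in> L2_vf M \<sigma>"
    by (intro L2.diff_mem L2 grad_L2 g h)+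
  have "?s u v - grad M ?k = ?s (u - grad M g) (v - grad M h)"
    unfolding grad_lincomb[OF g(1) h(1)]
    by (intro ext) (simp add: fscale_def tscale_def algebra_simps)
  then have "L2_norm M \<sigma> (?s u v - grad M ?k) = L2_norm M \<sigma> (?s (u - grad M g) (v - grad M h))"
    by (rule arg_cong)
  also have "\<dots> \<le> \<bar>a\<bar> * L2_norm M \<sigma> (u - grad M g) + \<bar>b\<bar> * L2_norm M \<sigma> (v - grad M h)"
    using L2.triangle[OF L2.sc_mem[OF L2'(1), of a] L2.sc_mem[OF L2'(2), of b]]
    unfolding L2_norm_eq L2.N_sc[OF L2'(1)] L2.N_sc[OF L2'(2)] .
  also have "\<dots> \<le> \<bar>a\<bar> * \<delta> + \<bar>b\<bar> * \<delta>"
    using g h by (intro add_mono mult_left_mono) auto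
  also have "\<dots> < (\<bar>a\<bar> + \<bar>b\<bar> + 1) * \<delta>" using \<delta> by (simp add: distrib_right)
  also have "\<dots> = \<epsilon>" unfolding \<delta>_def by (simp add: add_nonneg_eq_0_iff field_simps)
  finally show "\<exists>h. smooth_fun M h \<and> L2_norm M \<sigma> (?s u v - grad M h) < \<epsilon>"
    using smooth_fun_lincomb[OF g(1) h(1)] by blast
qed

sublocale hor: semi_inner_space "horizontal M \<sigma>" "\<lambda>r. fscale (\<lambda>_. r)" "L2_inner M \<sigma>"
proof
  fix u v w :: "('a, 'n) vfield" and r :: real
  assume u: "u \<in> horizontal M \<sigma>"
  show "fscale (\<lambda>_. r) u \<in> horizontal M \<sigma>"
  proof -
    have "fscale (\<lambda>_. r) u + fscale (\<lambda>_. 0) u = fscale (\<lambda>_. r) u"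
      by (intro ext) (simp add: fscale_def tscale_def)
    then show ?thesis using horizontal_lincomb[OF u u, of r 0] by simp
  qed
  show "fscale (\<lambda>_. - 1) u = - u" by (rule fscale_minus1)
  show "0 \<le> L2_inner M \<sigma> u u" by (intro L2.nonneg horizontal_L2 u)
  assume v: "v \<in> horizontal M \<sigma>"
  show "u + v \<in> horizontal M \<sigma>"
  proof -
    have "fscale (\<lambda>_. 1) u + fscale (\<lambda>_. 1) v = u + v"
      by (intro ext) (simp add: fscale_def tscale_def)
    then show ?thesis using horizontal_lincomb[OF u v, of 1 1] by simp
  qed
  show "L2_inner M \<sigma> u v = L2_inner M \<sigma> v u" by (intro L2.sym horizontal_L2 u v)
  show "L2_inner M \<sigma> (fscale (\<lambda>_. r) u) v = r * L2_inner M \<sigma> u v"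
    by (intro L2.sc_left horizontal_L2 u v)
  assume w: "w \<in> horizontal M \<sigma>"
  show "L2_inner M \<sigma> (u + w) v = L2_inner M \<sigma> u v + L2_inner M \<sigma> w v"
    by (intro L2.add_left horizontal_L2 u v w)
next
  show "0 \<in> horizontal M \<sigma>"
  proof -
    have "fscale (\<lambda>_. 0) v + fscale (\<lambda>_. 0) v = (0 :: ('a, 'n) vfield)" for v :: "('a, 'n) vfield"
      by (intro ext) (simp add: fscale_def tscale_def)
    then show ?thesis
      using horizontal_lincomb[OF grad_horizontal grad_horizontal, OF smooth_fun_zero smooth_fun_zero, of 0 0]
      by simp
  qed
qed

theorem horizontal_complete: hor.complete
  unfolding hor.complete_def
proof (intro allI impI, elim conjE)
  fix s :: "nat \<Rightarrow> ('a, 'n) vfield"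
  assume s: "\<forall>n. s n \<in> horizontal M \<sigma>"
    and cauchy: "\<forall>\<epsilon>>0. \<exists>K. \<forall>m\<ge>K. \<forall>n\<ge>K. L2.N (s m - s n) < \<epsilon>"
  have "\<exists>v\<in>L2_vf M \<sigma>. (\<lambda>n. L2.N (s n - v)) \<longlonglongrightarrow> 0"
    by (rule L2_complete[unfolded L2.complete_def, THEN spec, THEN mp])
      (use s cauchy horizontal_L2 in blast)
  then obtain v where v: "v \<in> L2_vf M \<sigma>" "(\<lambda>n. L2.N (s n - v)) \<longlonglongrightarrow> 0"
    by blast
  have "v \<in> horizontal M \<sigma>"
  proof (rule horizontal_closed[OF v(1)])
    fix \<epsilon> :: real assume "\<epsilon> > 0"
    then obtain n where "L2.N (s n - v) < \<epsilon>"
      using order_tendstoD(2)[OF v(2)] by (meson eventually_sequentially order_refl)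
    then show "\<exists>w\<in>horizontal M \<sigma>. L2_norm M \<sigma> (v - w) < \<epsilon>"
      using s L2.N_minus_commute[OF horizontal_L2 v(1)] by (auto simp: L2_norm_eq)
  qed
  then show "\<exists>v\<in>horizontal M \<sigma>. (\<lambda>n. L2.N (s n - v)) \<longlonglongrightarrow> 0" using v(2) by blast
qed

text \<open>The projection of \<open>v\<close> represents the functional \<open>u \<mapsto> \<langle>v, u\<rangle>\<close> on the complete space of horizontal
fields.\<close>

lemma
  assumes v: "v \<in> L2_vf M \<sigma>"
  shows hor_proj_horizontal: "hor_proj M \<sigma> v \<in> horizontal M \<sigma>"
    and hor_proj_orthogonal: "u \<in> horizontal M \<sigma> \<Longrightarrow> L2_inner M \<sigma> (v - hor_proj M \<sigma> v) u = 0"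
proof -
  have "\<exists>w\<in>horizontal M \<sigma>. \<forall>u\<in>horizontal M \<sigma>. L2_inner M \<sigma> w u = L2_inner M \<sigma> v u"
    using v
    by (intro hor.riesz_representation[where C = "L2.N v"] horizontal_complete L2.cauchy_schwarz)
      (simp_all add: horizontal_L2 L2.add_right L2.sc_right)
  then have "\<exists>w. w \<in> horizontal M \<sigma> \<and> (\<forall>u\<in>horizontal M \<sigma>. L2_inner M \<sigma> (v - w) u = 0)"
    using v by (auto simp: L2.diff_left horizontal_L2)
  from someI_ex[OF this]
  show "hor_proj M \<sigma> v \<in> horizontal M \<sigma>"
    "u \<in> horizontal M \<sigma> \<Longrightarrow> L2_inner M \<sigma> (v - hor_proj M \<sigma> v) u = 0"
    unfolding hor_proj_def by blast+
qed

text \<open>Replacing \<open>u\<close> by a nearby gradient changes the inner product arbitrarily little.\<close>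

lemma orthogonal_to_gradients:
  assumes v: "v \<in> L2_vf M \<sigma>"
    and orth: "\<And>h. smooth_fun M h \<Longrightarrow> L2_inner M \<sigma> v (grad M h) = 0"
    and u: "u \<in> horizontal M \<sigma>"
  shows "L2_inner M \<sigma> v u = 0"
proof -
  have "\<bar>L2_inner M \<sigma> v u\<bar> \<le> e" if "e > 0" for e
  proof -
    define d where "d = e / (L2.N v + 1)"
    have d: "d > 0" unfolding d_def using that L2.N_nonneg[OF v] by (intro divide_pos_pos) auto
    obtain h where h: "smooth_fun M h" "L2_norm M \<sigma> (u - grad M h) < d"
      using horizontal_approx[OF u d] .
    have "L2_inner M \<sigma> v u = L2_inner M \<sigma> v (u - grad M h)"
      using orth[OF h(1)] by (simp add: L2.diff_right v horizontal_L2 u grad_L2 h(1))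
    also have "\<bar>\<dots>\<bar> \<le> L2.N v * L2.N (u - grad M h)"
      by (intro L2.cauchy_schwarz v L2.diff_mem horizontal_L2 u grad_L2 h(1))
    also have "\<dots> \<le> (L2.N v + 1) * d"
      using h(2) L2.N_nonneg[OF v] L2.N_nonneg[OF L2.diff_mem[OF horizontal_L2[OF u] grad_L2[OF h(1)]]]
      by (intro mult_mono) (auto simp: L2_norm_eq)
    also have "\<dots> = e" unfolding d_def using L2.N_nonneg[OF v] by simp
    finally show ?thesis .
  qed
  then have "\<bar>L2_inner M \<sigma> v u\<bar> \<le> 0" using field_le_epsilon[of "\<bar>L2_inner M \<sigma> v u\<bar>" 0] by simp
  then show ?thesis by simp
qed

section \<open>Sobolev functions and the dual norm\<close>

lemma unweighted: "weighted_manifold M (\<lambda>_. 1)"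
  by (intro weighted_manifold.intro weighted_manifold_axioms.intro closed_riemannian_axioms
      finite_volume) simp_all

text \<open>The weight is bounded above on the compact manifold.\<close>

lemma unweighted_comparison:
  "\<exists>B\<ge>0. \<forall>v\<in>L2_vf M (\<lambda>_. 1). v \<in> L2_vf M \<sigma> \<and> L2_norm M \<sigma> v \<le> B * L2_norm M (\<lambda>_. 1) v"
proof -
  interpret U: weighted_manifold M "\<lambda>_. 1" by (rule unweighted)
  obtain p1 where p1: "\<And>p. \<sigma> p \<le> \<sigma> p1"
    using continuous_attains_sup[OF compact_manifold UNIV_not_empty weight_cont] by blast
  have "v \<in> L2_vf M \<sigma> \<and> L2_norm M \<sigma> v \<le> sqrt (\<sigma> p1) * L2_norm M (\<lambda>_. 1) v"
    if v: "v \<in> L2_vf M (\<lambda>_. 1)" for v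
  proof -
    let ?g = "\<lambda>p. gmet M p (v p) (v p)"
    have nn: "?g p \<ge> 0" for p by (rule gmet_nonneg[OF U.L2_vf_tangent[OF v]])
    have le: "?g p * \<sigma> p \<le> \<sigma> p1 * ?g p" for p
      using mult_left_mono[OF p1 nn] by (simp add: mult.commute)
    have int: "integrable (dvol M) (\<lambda>p. \<sigma> p1 * ?g p)"
      using U.L2_vf_integrable[OF v] by simp
    have int': "integrable (dvol M) (\<lambda>p. ?g p * \<sigma> p)"
    proof (rule Bochner_Integration.integrable_bound[OF int])
      show "(\<lambda>p. ?g p * \<sigma> p) \<in> borel_measurable (dvol M)"
        by (intro weighted_gmet_measurable U.L2_vf_field U.L2_vf_measurable v)
      show "AE p in dvol M. norm (?g p * \<sigma> p) \<le> norm (\<sigma> p1 * ?g p)"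
        using le nn weight_pos by (simp add: abs_mult abs_of_nonneg abs_of_pos)
    qed
    have "L2_inner M \<sigma> v v \<le> \<sigma> p1 * L2_inner M (\<lambda>_. 1) v v"
      using integral_mono[OF int' int le] by (simp add: L2_inner_def)
    then have "L2_norm M \<sigma> v \<le> sqrt (\<sigma> p1) * L2_norm M (\<lambda>_. 1) v"
      unfolding L2_norm_def real_sqrt_mult[symmetric] by (rule real_sqrt_le_mono)
    then show ?thesis
      using L2_vfI[OF U.L2_vf_field[OF v] U.L2_vf_measurable[OF v] int'] by blast
  qed
  then show ?thesis using weight_pos[of p1] by (intro exI[of _ "sqrt (\<sigma> p1)"]) (simp add: less_imp_le)
qed

text \<open>A weak gradient is a limit of gradients in the unweighted norm, hence in the weighted one. This
turns statements on Sobolev functions into statements on horizontal fields.\<close>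

lemma H1_horizontal:
  assumes "(u, V) \<in> H1 M"
  shows "V \<in> horizontal M \<sigma>"
proof -
  interpret U: weighted_manifold M "\<lambda>_. 1" by (rule unweighted)
  obtain h where V: "V \<in> L2_vf M (\<lambda>_. 1)" and h: "\<And>n::nat. smooth_fun M (h n)"
    and lim: "(\<lambda>n. L2_norm M (\<lambda>_. 1) (grad M (h n) - V)) \<longlonglongrightarrow> 0"
    using assms unfolding H1_def by blast
  obtain B where B: "B \<ge> 0" "\<And>v. v \<in> L2_vf M (\<lambda>_. 1) \<Longrightarrow> v \<in> L2_vf M \<sigma>"
    "\<And>v. v \<in> L2_vf M (\<lambda>_. 1) \<Longrightarrow> L2_norm M \<sigma> v \<le> B * L2_norm M (\<lambda>_. 1) v"
    using unweighted_comparison by blast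
  show ?thesis
  proof (rule horizontalI)
    show VL2: "V \<in> L2_vf M \<sigma>" by (rule B(2)[OF V])
    fix \<epsilon> :: real assume e: "\<epsilon> > 0"
    have "(\<lambda>n. B * L2_norm M (\<lambda>_. 1) (grad M (h n) - V)) \<longlonglongrightarrow> B * 0"
      by (intro tendsto_mult_left lim)
    then have "\<forall>\<^sub>F n in sequentially. B * L2_norm M (\<lambda>_. 1) (grad M (h n) - V) < \<epsilon>"
      using e by (intro order_tendstoD(2)) simp_all
    then obtain n where n: "B * L2_norm M (\<lambda>_. 1) (grad M (h n) - V) < \<epsilon>"
      by (auto simp: eventually_sequentially)
    have "L2_norm M \<sigma> (V - grad M (h n)) = L2_norm M \<sigma> (grad M (h n) - V)"
      unfolding L2_norm_eq by (rule L2.N_minus_commute[OF VL2 grad_L2[OF h]])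
    also have "\<dots> < \<epsilon>"
      using B(3)[OF U.L2.diff_mem[OF U.grad_L2[OF h] V], of n] n by linarith
    finally show "\<exists>h. smooth_fun M h \<and> L2_norm M \<sigma> (V - grad M h) < \<epsilon>" using h by blast
  qed
qed

lemma smooth_fun_H1:
  assumes h: "smooth_fun M h"
  shows "(h, grad M h) \<in> H1 M"
proof -
  interpret U: weighted_manifold M "\<lambda>_. 1" by (rule unweighted)
  have cont: "continuous_on UNIV h" by (rule smooth_fun_continuous[OF h])
  have "h \<in> borel_measurable borel" "integrable (dvol M) (\<lambda>p. (h p)\<^sup>2)"
    by (auto intro!: borel_measurable_continuous_onI continuous_integrable continuous_intros cont)
  moreover have "L2_norm M (\<lambda>_. 1) (grad M h - grad M h) = 0"
    by (simp add: U.L2_norm_eq_0_iff[OF U.L2_vf_zero] L2_eq_def)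
  ultimately show ?thesis
    unfolding H1_def using h U.grad_L2[OF h] by (auto intro!: exI[of _ "\<lambda>_. h"])
qed

lemma H1_diff_smooth:
  assumes uV: "(u, V) \<in> H1 M" and h: "smooth_fun M h"
  shows "(u - h, V - grad M h) \<in> H1 M"
proof -
  interpret U: weighted_manifold M "\<lambda>_. 1" by (rule unweighted)
  obtain s where V: "V \<in> L2_vf M (\<lambda>_. 1)" and s: "\<And>n::nat. smooth_fun M (s n)"
    and u: "u \<in> borel_measurable borel" "integrable (dvol M) (\<lambda>p. (u p)\<^sup>2)"
    and lim: "(\<lambda>n. sqrt (\<integral>p. (s n p - u p)\<^sup>2 \<partial>dvol M)) \<longlonglongrightarrow> 0"
      "(\<lambda>n. L2_norm M (\<lambda>_. 1) (grad M (s n) - V)) \<longlonglongrightarrow> 0"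
    using uV unfolding H1_def by blast
  have cont: "continuous_on UNIV h" by (rule smooth_fun_continuous[OF h])
  have meas: "u - h \<in> borel_measurable borel"
    using borel_measurable_diff[OF u(1) borel_measurable_continuous_onI[OF cont]]
    by (simp add: fun_diff_def)
  have "integrable (dvol M) (\<lambda>p. ((u - h) p)\<^sup>2)"
  proof (rule Bochner_Integration.integrable_bound)
    show "integrable (dvol M) (\<lambda>p. 2 * (u p)\<^sup>2 + 2 * (h p)\<^sup>2)"
      by (intro Bochner_Integration.integrable_add integrable_mult_right u(2) continuous_integrable
          continuous_intros cont)
    show "(\<lambda>p. ((u - h) p)\<^sup>2) \<in> borel_measurable (dvol M)"
      unfolding measurable_volume by (intro borel_measurable_power meas)
    have "(x - y)\<^sup>2 \<le> 2 * x\<^sup>2 + 2 * y\<^sup>2" for x y :: real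
      using zero_le_power2[of "x + y"] by (simp add: power2_eq_square algebra_simps)
    then show "AE p in dvol M. norm (((u - h) p)\<^sup>2) \<le> norm (2 * (u p)\<^sup>2 + 2 * (h p)\<^sup>2)"
      by (intro AE_I2) simp
  qed
  moreover have "V - grad M h \<in> L2_vf M (\<lambda>_. 1)"
    by (intro U.L2.diff_mem V U.grad_L2 h)
  moreover have "smooth_fun M (\<lambda>p. s n p - h p)" for n
    using smooth_fun_lincomb[OF s h, of 1 n "-1"] by simp
  moreover have "(\<lambda>n. L2_norm M (\<lambda>_. 1) (grad M (\<lambda>p. s n p - h p) - (V - grad M h))) \<longlonglongrightarrow> 0"
    using lim(2) by (simp add: grad_diff[OF s h])
  ultimately show ?thesis
    unfolding H1_def using meas lim(1) by (auto intro!: exI[of _ "\<lambda>n p. s n p - h p"])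
qed

lemma inner_in_Hdot_dual:
  assumes X: "X \<in> L2_vf M \<sigma>"
  shows "(\<lambda>(u, V). L2_inner M \<sigma> X V) \<in> Hdot_dual M \<sigma>"
proof -
  have L2: "V \<in> L2_vf M \<sigma>" if "(u, V) \<in> H1 M" for u V
    by (rule horizontal_L2[OF H1_horizontal[OF that]])
  have "\<bar>L2_inner M \<sigma> X V\<bar> \<le> L2.N X * L2_norm M \<sigma> V" if "(u, V) \<in> H1 M" for u V
    unfolding L2_norm_eq by (rule L2.cauchy_schwarz[OF X L2[OF that]])
  then show ?thesis
    unfolding Hdot_dual_def using L2 X by (auto simp: L2.add_right L2.sc_right)
qed

text \<open>Both sides are additive and bounded by a multiple of the norm of the weak gradient, and they agree on
smooth functions. Subtracting from \<open>(u, V)\<close> a smooth function whose gradient is close to \<open>V\<close> makes their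
difference arbitrarily small.\<close>

lemma extension_unique:
  assumes X: "X \<in> L2_vf M \<sigma>"
    and T: "\<And>h. smooth_fun M h \<Longrightarrow> T h = L2_inner M \<sigma> X (grad M h)"
    and \<Lambda>: "\<Lambda> \<in> Hdot_dual M \<sigma>" "extends_distr M \<Lambda> T"
    and uV: "(u, V) \<in> H1 M"
  shows "\<Lambda> (u, V) = L2_inner M \<sigma> X V"
proof -
  have V: "V \<in> L2_vf M \<sigma>" by (rule horizontal_L2[OF H1_horizontal[OF uV]])
  obtain C where C: "\<And>u V. (u, V) \<in> H1 M \<Longrightarrow> \<bar>\<Lambda> (u, V)\<bar> \<le> C * L2_norm M \<sigma> V"
    using \<Lambda>(1) unfolding Hdot_dual_def by blast
  have add: "\<Lambda> (u + u', V + V') = \<Lambda> (u, V) + \<Lambda> (u', V')"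
    if "(u, V) \<in> H1 M" "(u', V') \<in> H1 M" for u V u' V'
    using \<Lambda>(1) that unfolding Hdot_dual_def by blast
  define K where "K = \<bar>C\<bar> + L2.N X + 1"
  have K: "K > 0" unfolding K_def using L2.N_nonneg[OF X] by simp
  have "\<bar>\<Lambda> (u, V) - L2_inner M \<sigma> X V\<bar> \<le> e" if "e > 0" for e
  proof -
    obtain h where h: "smooth_fun M h" "L2_norm M \<sigma> (V - grad M h) < e / K"
      using horizontal_approx[OF H1_horizontal[OF uV], of "e / K"] K \<open>e > 0\<close> by auto
    let ?W = "V - grad M h"
    have WH: "(u - h, ?W) \<in> H1 M" by (rule H1_diff_smooth[OF uV h(1)])
    have W: "?W \<in> L2_vf M \<sigma>" by (intro L2.diff_mem V grad_L2 h(1))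
    have "\<Lambda> (u, V) = \<Lambda> (u - h, ?W) + \<Lambda> (h, grad M h)"
      using add[OF WH smooth_fun_H1[OF h(1)]] by simp
    also have "\<Lambda> (h, grad M h) = L2_inner M \<sigma> X (grad M h)"
      using \<Lambda>(2) h(1) T by (simp add: extends_distr_def)
    finally have "\<Lambda> (u, V) - L2_inner M \<sigma> X V = \<Lambda> (u - h, ?W) - L2_inner M \<sigma> X ?W"
      unfolding L2.diff_right[OF X V grad_L2[OF h(1)]] by linarith
    also have "\<bar>\<dots>\<bar> \<le> \<bar>C\<bar> * L2.N ?W + L2.N X * L2.N ?W"
      using C[OF WH] L2.cauchy_schwarz[OF X W] mult_right_mono[OF abs_ge_self[of C] L2.N_nonneg[OF W]]
      unfolding L2_norm_eq by linarith
    also have "\<dots> \<le> K * L2.N ?W"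
      using L2.N_nonneg[OF W] by (simp add: K_def algebra_simps)
    also have "\<dots> \<le> e"
      using h(2) K by (simp add: L2_norm_eq field_simps)
    finally show ?thesis .
  qed
  then show ?thesis
    using field_le_epsilon[of "\<bar>\<Lambda> (u, V) - L2_inner M \<sigma> X V\<bar>" 0] by simp
qed

text \<open>The upper bound is the Cauchy-Schwarz inequality. For the lower bound the functional is tested with
gradients close to \<open>D\<close>, scaled to length one; these exist because \<open>D\<close> is horizontal.\<close>

lemma dual_norm_horizontal:
  assumes D: "D \<in> horizontal M \<sigma>"
    and \<Lambda>: "\<And>u V. (u, V) \<in> H1 M \<Longrightarrow> \<Lambda> (u, V) = L2_inner M \<sigma> D V"
  shows "Hdot_dual_norm M \<sigma> \<Lambda> = L2_norm M \<sigma> D"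
proof -
  note DL2 = horizontal_L2[OF D]
  let ?S = "{\<bar>\<Lambda> (u, V)\<bar> | u V. (u, V) \<in> H1 M \<and> L2_norm M \<sigma> V \<le> 1}"
  have gradL2: "grad M h \<in> L2_vf M \<sigma>" if "smooth_fun M h" for h by (rule grad_L2[OF that])
  have zero_in_S: "\<bar>\<Lambda> (\<lambda>_. 0, grad M (\<lambda>_. 0))\<bar> \<in> ?S"
  proof -
    have "grad M (\<lambda>_. 0) = 0"
      using grad_diff[OF smooth_fun_zero smooth_fun_zero] by simp
    then have "L2_norm M \<sigma> (grad M (\<lambda>_. 0)) \<le> 1"
      by (simp add: L2_norm_eq_0_iff[OF L2_vf_zero, THEN iffD2] L2_eq_def)
    then show ?thesis using smooth_fun_H1[OF smooth_fun_zero] by blast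
  qed
  have "Sup ?S = L2.N D"
  proof (rule cSup_eq_non_empty)
    show "?S \<noteq> {}" using zero_in_S by blast
  next
    fix x assume "x \<in> ?S"
    then obtain u V where uV: "(u, V) \<in> H1 M" "L2.N V \<le> 1" "x = \<bar>\<Lambda> (u, V)\<bar>"
      unfolding L2_norm_eq by blast
    have "x \<le> L2.N D * L2.N V"
      unfolding uV(3) \<Lambda>[OF uV(1)]
      by (rule L2.cauchy_schwarz[OF DL2 horizontal_L2[OF H1_horizontal[OF uV(1)]]])
    also have "\<dots> \<le> L2.N D" using uV(2) L2.N_nonneg[OF DL2] by (simp add: mult_left_le)
    finally show "x \<le> L2.N D" .
  next
    fix y assume y: "\<And>x. x \<in> ?S \<Longrightarrow> x \<le> y"
    \<comment> \<open>homogeneity extends the bound \<open>y\<close> from the unit ball to all gradients\<close>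
    have test: "\<bar>L2_inner M \<sigma> D (grad M h)\<bar> \<le> y * L2.N (grad M h)" if h: "smooth_fun M h" for h
    proof (cases "L2.N (grad M h) = 0")
      case True
      then show ?thesis using L2.cauchy_schwarz[OF DL2 gradL2[OF h]] by simp
    next
      case False
      define a where "a = 1 / L2.N (grad M h)"
      have a: "a > 0" unfolding a_def using False L2.N_nonneg[OF gradL2[OF h]] by simp
      have "fscale (\<lambda>_. 0) (grad M h) = 0"
        by (intro ext) (simp add: fscale_def tscale_def)
      then have g: "grad M (\<lambda>p. a * h p) = fscale (\<lambda>_. a) (grad M h)"
        using grad_lincomb[OF h h, of a 0] by simp
      have sm: "smooth_fun M (\<lambda>p. a * h p)"
        using smooth_fun_lincomb[OF h h, of a 0] by simp
      have "L2_norm M \<sigma> (grad M (\<lambda>p. a * h p)) = a * L2.N (grad M h)"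
        unfolding L2_norm_eq g L2.N_sc[OF gradL2[OF h]] using a by simp
      also have "\<dots> = 1" using False by (simp add: a_def)
      finally have "\<bar>\<Lambda> (\<lambda>p. a * h p, grad M (\<lambda>p. a * h p))\<bar> \<le> y"
        using smooth_fun_H1[OF sm] by (intro y) force
      then have "\<bar>a * L2_inner M \<sigma> D (grad M h)\<bar> \<le> y"
        unfolding \<Lambda>[OF smooth_fun_H1[OF sm]]
        unfolding g L2.sc_right[OF DL2 gradL2[OF h]] .
      then show ?thesis
        using a L2.N_nonneg[OF gradL2[OF h]] False
        by (simp add: abs_mult a_def field_simps)
    qed
    define d where "d = L2.N D"
    have d: "d \<ge> 0" unfolding d_def by (rule L2.N_nonneg[OF DL2])
    show "L2.N D \<le> y"
    proof (cases "d = 0")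
      case True
      have "\<bar>\<Lambda> (\<lambda>_. 0, grad M (\<lambda>_. 0))\<bar> \<le> y" by (rule y[OF zero_in_S])
      then show ?thesis using True by (simp add: d_def)
    next
      case False
      then have dpos: "d > 0" using d by simp
      \<comment> \<open>testing with a gradient at distance less than \<open>\<epsilon>\<close> from \<open>D\<close>\<close>
      have eps: "d * d \<le> y * d + \<epsilon> * (\<bar>y\<bar> + d)" if e: "\<epsilon> > 0" for \<epsilon>
      proof -
        obtain h where h: "smooth_fun M h" "L2_norm M \<sigma> (D - grad M h) < \<epsilon>"
          using horizontal_approx[OF D e] .
        let ?W = "D - grad M h"
        have W: "?W \<in> L2_vf M \<sigma>" by (intro L2.diff_mem DL2 gradL2 h(1))
        have We: "L2.N ?W < \<epsilon>" using h(2) by (simp add: L2_norm_eq)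
        have "d * d = L2_inner M \<sigma> D D"
          using L2.N_squared[OF DL2] by (simp add: d_def power2_eq_square)
        also have "\<dots> = L2_inner M \<sigma> D ?W + L2_inner M \<sigma> D (grad M h)"
          by (simp add: L2.diff_right DL2 gradL2 h(1))
        also have "\<dots> \<le> d * \<epsilon> + y * L2.N (grad M h)"
          using L2.cauchy_schwarz[OF DL2 W] test[OF h(1)] mult_left_mono[OF less_imp_le[OF We] d]
          by (simp add: d_def)
        also have "y * L2.N (grad M h) \<le> y * d + \<bar>y\<bar> * \<epsilon>"
        proof -
          have "L2.N (grad M h) \<le> d + \<epsilon>" "d \<le> L2.N (grad M h) + \<epsilon>"
            using L2.triangle[OF DL2 L2.minus_mem[OF W]] L2.triangle[OF W gradL2[OF h(1)]] We
              L2.N_minus_commute[OF DL2 gradL2[OF h(1)]]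
            by (simp_all add: d_def)
          then have "\<bar>L2.N (grad M h) - d\<bar> \<le> \<epsilon>" by linarith
          then have "\<bar>y * (L2.N (grad M h) - d)\<bar> \<le> \<bar>y\<bar> * \<epsilon>"
            unfolding abs_mult by (intro mult_left_mono) auto
          then show ?thesis by (simp add: right_diff_distrib)
        qed
        finally show ?thesis by (simp add: algebra_simps)
      qed
      have "d * d \<le> y * d"
      proof (rule field_le_epsilon)
        fix e :: real assume "e > 0"
        have "\<bar>y\<bar> + d > 0" using dpos by simp
        then show "d * d \<le> y * d + e"
          using eps[of "e / (\<bar>y\<bar> + d)"] \<open>e > 0\<close> by simp
      qed
      then show ?thesis using dpos by (simp add: d_def)
    qed
  qed
  then show ?thesis by (simp add: Hdot_dual_norm_def L2_norm_eq)
qed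

theorem Hdot_minus1_horizontal:
  assumes D: "D \<in> horizontal M \<sigma>"
    and T: "\<And>h. smooth_fun M h \<Longrightarrow> T h = L2_inner M \<sigma> D (grad M h)"
  shows "in_Hdot_minus1 M \<sigma> T" "Hdot_minus1_norm M \<sigma> T = L2_norm M \<sigma> D"
proof -
  note DL2 = horizontal_L2[OF D]
  let ?L = "\<lambda>(u, V). L2_inner M \<sigma> D V"
  have L: "?L \<in> Hdot_dual M \<sigma>" "extends_distr M ?L T"
    by (rule inner_in_Hdot_dual[OF DL2]) (simp add: extends_distr_def T)
  show "in_Hdot_minus1 M \<sigma> T"
    unfolding in_Hdot_minus1_def using L by blast
  have norm: "Hdot_dual_norm M \<sigma> \<Lambda> = L2_norm M \<sigma> D"
    if "\<Lambda> \<in> Hdot_dual M \<sigma>" "extends_distr M \<Lambda> T" for \<Lambda>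
    by (rule dual_norm_horizontal[OF D extension_unique[OF DL2 T that]])
  show "Hdot_minus1_norm M \<sigma> T = L2_norm M \<sigma> D"
    unfolding Hdot_minus1_norm_def by (rule the_equality) (use L norm in metis)+
qed

section \<open>The adjoint of the inclusion\<close>

lemma inclusion_L2:
  assumes "continuously_in_C1 M H ip" "v \<in> H"
  shows "v \<in> L2_vf M \<sigma>"
  using assms by (intro continuous_field_L2 C1_continuous_field) (auto simp: continuously_in_C1_def)

text \<open>Integrate the pointwise bound, whose constant does not depend on the point.\<close>

lemma inclusion_bounded:
  assumes rk: "rkhs M k H ip" and C1: "continuously_in_C1 M H ip"
  shows "\<exists>C\<ge>0. \<forall>v\<in>H. L2_norm M \<sigma> v \<le> C * Hnorm ip v"
proof -
  interpret H: semi_inner_space H "\<lambda>r. fscale (\<lambda>_. r)" ip by (rule rkhs_semi_inner(1)[OF rk])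
  obtain B where B: "\<And>v p. v \<in> H \<Longrightarrow> gmet M p (v p) (v p) \<le> B * (Hnorm ip v)\<^sup>2"
    using bounded_evaluation[OF C1] by blast
  define c where "c = \<bar>B\<bar> * (\<integral>p. \<sigma> p \<partial>dvol M)"
  have c: "c \<ge> 0"
    unfolding c_def using weight_pos
    by (intro mult_nonneg_nonneg Bochner_Integration.integral_nonneg) (auto simp: less_imp_le)
  have "L2_norm M \<sigma> v \<le> sqrt c * Hnorm ip v" if v: "v \<in> H" for v
  proof -
    have "B * (Hnorm ip v)\<^sup>2 \<le> \<bar>B\<bar> * (Hnorm ip v)\<^sup>2" by (intro mult_right_mono) auto
    then have "gmet M p (v p) (v p) * \<sigma> p \<le> (\<bar>B\<bar> * (Hnorm ip v)\<^sup>2) * \<sigma> p" for p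
      using B[OF v, of p] weight_pos[of p] by (intro mult_right_mono) auto
    then have "L2_inner M \<sigma> v v \<le> (\<integral>p. (\<bar>B\<bar> * (Hnorm ip v)\<^sup>2) * \<sigma> p \<partial>dvol M)"
      unfolding L2_inner_def
      by (intro integral_mono L2_vf_integrable inclusion_L2[OF C1 v] integrable_mult_right
          continuous_integrable weight_cont)
    also have "\<dots> = c * (Hnorm ip v)\<^sup>2" by (simp add: c_def mult_ac)
    finally have "L2_norm M \<sigma> v \<le> sqrt (c * (Hnorm ip v)\<^sup>2)"
      unfolding L2_norm_def by (rule real_sqrt_le_mono)
    moreover have "Hnorm ip v \<ge> 0" using H.nonneg[OF v] by (simp add: Hnorm_def)
    ultimately show ?thesis by (simp add: real_sqrt_mult)
  qed
  moreover have "sqrt c \<ge> 0" using c by (rule real_sqrt_ge_zero)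
  ultimately show ?thesis by blast
qed

text \<open>The description that defines the adjoint has a solution by Riesz representation of the functional
\<open>u \<mapsto> \<langle>u, v\<rangle>\<close>, and only one because the inner product of the reproducing kernel space is
definite on everywhere defined fields.\<close>

lemma incl_adj_mem:
  assumes rk: "rkhs M k H ip" and C1: "continuously_in_C1 M H ip" and v: "v \<in> L2_vf M \<sigma>"
  shows "incl_adj M \<sigma> H ip v \<in> H"
proof -
  interpret H: semi_inner_space H "\<lambda>r. fscale (\<lambda>_. r)" ip by (rule rkhs_semi_inner(1)[OF rk])
  note HL2 = inclusion_L2[OF C1]
  obtain C where C: "C \<ge> 0" "\<And>u. u \<in> H \<Longrightarrow> L2_norm M \<sigma> u \<le> C * Hnorm ip u"
    using inclusion_bounded[OF rk C1] by auto
  have "\<bar>L2_inner M \<sigma> u v\<bar> \<le> (C * L2.N v) * H.N u" if u: "u \<in> H" for u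
  proof -
    have "\<bar>L2_inner M \<sigma> u v\<bar> \<le> L2.N u * L2.N v" by (intro L2.cauchy_schwarz HL2 u v)
    also have "\<dots> \<le> (C * H.N u) * L2.N v"
      using C(2)[OF u] L2.N_nonneg[OF v] by (intro mult_right_mono) (auto simp: H.N_def Hnorm_def L2_norm_eq)
    finally show ?thesis by (simp add: mult_ac)
  qed
  then have "\<exists>w\<in>H. \<forall>u\<in>H. ip w u = L2_inner M \<sigma> u v"
    using HL2 v
    by (intro H.riesz_representation[where C = "C * L2.N v"] rkhs_semi_inner(2)[OF rk])
      (simp_all add: L2.add_left L2.sc_left)
  then obtain w where w: "w \<in> H" "\<And>u. u \<in> H \<Longrightarrow> ip u w = L2_inner M \<sigma> u v"
    using H.sym by metis
  let ?P = "\<lambda>w. w \<in> H \<and> (\<forall>u\<in>H. ip u w = L2_inner M \<sigma> (incl u) v)"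
  have "?P (incl_adj M \<sigma> H ip v)"
    unfolding incl_adj_def
  proof (rule theI[of ?P w])
    show "?P w" using w by (simp add: incl_def)
    fix w' assume w': "?P w'"
    then have "ip (w' - w) (w' - w) = 0"
      using w by (simp add: H.diff_right H.diff_mem incl_def)
    then have "w' - w = 0"
      using w w' by (intro rkhs_definite[OF rk]) (auto intro: H.diff_mem)
    then show "w' = w" by simp
  qed
  then show ?thesis by blast
qed

section \<open>Otto and Stein tangents\<close>

text \<open>The common form of both density tangents: pairing with gradients in the weighted inner product.\<close>

lemma neg_distr_div_weighted:
  assumes X: "X \<in> vector_fields M"
  shows "(- distr_div M (fscale \<sigma> X)) h = (if smooth_fun M h then L2_inner M \<sigma> X (grad M h) else 0)"
proof -
  have "gmet M p (fscale \<sigma> X p) (grad M h p) = gmet M p (X p) (grad M h p) * \<sigma> p"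
    if "smooth_fun M h" for p
    using gmet_scale_left[OF vfieldD[OF X] grad_mem[OF that]] by (simp add: fscale_def mult.commute)
  then show ?thesis by (simp add: distr_div_def L2_inner_def)
qed

end

context closed_riemannian
begin

text \<open>An integral with value \<open>1\<close> is not the default value \<open>0\<close> of a divergent one, so the density is
integrable; being bounded below by a positive constant, it forces the volume to be finite.\<close>

lemma weighted_manifold_density:
  assumes "smooth_pos_density M \<rho>"
  shows "weighted_manifold M \<rho>"
proof (intro weighted_manifold.intro weighted_manifold_axioms.intro closed_riemannian_axioms)
  have \<rho>: "smooth_fun M \<rho>" "\<And>p. \<rho> p > 0" "(\<integral>p. \<rho> p \<partial>dvol M) = 1"
    using assms by (simp_all add: smooth_pos_density_def)
  show "\<rho> p > 0" for p by (rule \<rho>(2))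
  show cont: "continuous_on UNIV \<rho>" by (rule smooth_fun_continuous[OF \<rho>(1)])
  obtain p0 where p0: "\<And>p. \<rho> p0 \<le> \<rho> p"
    using continuous_attains_inf[OF compact_manifold UNIV_not_empty cont] by blast
  have "integrable (dvol M) \<rho>"
    using not_integrable_integral_eq[of "dvol M" \<rho>] \<rho>(3) by fastforce
  then have "integrable (dvol M) (\<lambda>_. \<rho> p0)"
    by (rule Bochner_Integration.integrable_bound)
      (use p0 \<rho>(2) in \<open>auto intro!: AE_I2 simp: abs_of_pos\<close>)
  then have "emeasure (dvol M) (space (dvol M)) < \<infinity>"
    using \<rho>(2)[of p0] by (auto simp: integrable_iff_bounded ennreal_mult_less_top)
  then show "finite_measure (dvol M)" by (intro finite_measureI) simp
qed

end

theorem theorem7p2: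
  fixes M :: "('a::{t2_space, second_countable_topology}, 'n::finite) riem"
    and \<rho> f :: "'a \<Rightarrow> real"
    and k :: "('a, 'n) vkernel"
    and H :: "('a, 'n) vfield set"
    and ip :: "('a, 'n) vfield \<Rightarrow> ('a, 'n) vfield \<Rightarrow> real"
  assumes "closed_oriented_riemannian M"
    and "smooth_pd_kernel M k"
    and "rkhs M k H ip"
    and "continuously_in_C1 M H ip"
    and "smooth_pos_density M \<rho>"
    and "smooth_fun M f"
  shows "(K_W M \<rho> f = K_S M \<rho> H ip f \<longleftrightarrow>
            L2_eq M (M_op M \<rho> H ip (grad M f)) (grad M f)) \<and>
         (L2_eq M (- grad M f) (- S_op M \<rho> H ip (grad M f)) \<longleftrightarrow>
            L2_eq M (S_op M \<rho> H ip (grad M f)) (grad M f)) \<and>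
         (K_W M \<rho> f = K_S M \<rho> H ip f \<longrightarrow>
            S_op M \<rho> H ip (grad M f) - grad M f \<in> ker_A M \<rho>) \<and>
         in_Hdot_minus1 M \<rho> (K_S M \<rho> H ip f - K_W M \<rho> f) \<and>
         Hdot_minus1_norm M \<rho> (K_S M \<rho> H ip f - K_W M \<rho> f) =
           L2_norm M \<rho> (M_op M \<rho> H ip (grad M f) - grad M f)"
proof -
  interpret closed_riemannian M by unfold_locales fact
  interpret weighted_manifold M \<rho> by (rule weighted_manifold_density) fact
  note f = assms(6)
  define v w P where "v = grad M f" and "w = S_op M \<rho> H ip v" and "P = M_op M \<rho> H ip v"
  have v: "v \<in> horizontal M \<rho>" "v \<in> L2_vf M \<rho>"
    unfolding v_def by (rule grad_horizontal[OF f], rule grad_L2[OF f])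
  have w_eq: "w = incl_adj M \<rho> H ip v" by (simp add: w_def S_op_def incl_def)
  have w: "w \<in> L2_vf M \<rho>"
    unfolding w_eq by (intro inclusion_L2[OF assms(4)] incl_adj_mem[OF assms(3,4) v(2)])
  have P_eq: "P = hor_proj M \<rho> w" by (simp add: P_def M_op_def w_def)
  have P: "P \<in> horizontal M \<rho>" unfolding P_eq by (rule hor_proj_horizontal[OF w])
  define D where "D = P - v"
  have D: "D \<in> horizontal M \<rho>" unfolding D_def by (intro hor.diff_mem P v)
  have K_W: "K_W M \<rho> f h = (if smooth_fun M h then L2_inner M \<rho> v (grad M h) else 0)" for h
    unfolding K_W_def v_def[symmetric] by (rule neg_distr_div_weighted[OF L2_vf_field[OF v(2)]])
  have K_S: "K_S M \<rho> H ip f h = (if smooth_fun M h then L2_inner M \<rho> w (grad M h) else 0)" for h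
    unfolding K_S_def v_def[symmetric] w_eq[symmetric]
    by (rule neg_distr_div_weighted[OF L2_vf_field[OF w]])
  have defect: "L2_inner M \<rho> w (grad M h) - L2_inner M \<rho> v (grad M h) = L2_inner M \<rho> D (grad M h)"
    if h: "smooth_fun M h" for h
  proof -
    have "L2_inner M \<rho> w (grad M h) - L2_inner M \<rho> P (grad M h) = 0"
      using hor_proj_orthogonal[OF w grad_horizontal[OF h]]
      by (simp add: P_eq[symmetric] L2.diff_left w horizontal_L2 P grad_L2 h)
    then show ?thesis
      unfolding D_def by (simp add: L2.diff_left horizontal_L2 P v grad_L2 h)
  qed
  have tangents_eq: "K_W M \<rho> f = K_S M \<rho> H ip f \<longleftrightarrow>
      (\<forall>h. smooth_fun M h \<longrightarrow> L2_inner M \<rho> D (grad M h) = 0)"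
  proof (intro iffI allI impI ext)
    fix h assume eq: "K_W M \<rho> f = K_S M \<rho> H ip f" and h: "smooth_fun M h"
    have "L2_inner M \<rho> v (grad M h) = L2_inner M \<rho> w (grad M h)"
      using K_W[of h] K_S[of h] h eq by simp
    then show "L2_inner M \<rho> D (grad M h) = 0" using defect[OF h] by linarith
  next
    fix h assume orth: "\<forall>h. smooth_fun M h \<longrightarrow> L2_inner M \<rho> D (grad M h) = 0"
    show "K_W M \<rho> f h = K_S M \<rho> H ip f h"
    proof (cases "smooth_fun M h")
      case True
      then have "L2_inner M \<rho> v (grad M h) = L2_inner M \<rho> w (grad M h)"
        using defect[OF True] orth by simp
      then show ?thesis unfolding K_W K_S by simp
    qed (simp add: K_W K_S)
  qed
  have D0: "(\<forall>h. smooth_fun M h \<longrightarrow> L2_inner M \<rho> D (grad M h) = 0) \<longleftrightarrow> L2_norm M \<rho> D = 0"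
  proof
    assume "\<forall>h. smooth_fun M h \<longrightarrow> L2_inner M \<rho> D (grad M h) = 0"
    then have "L2_inner M \<rho> D D = 0"
      using orthogonal_to_gradients[OF horizontal_L2[OF D] _ D] by blast
    then show "L2_norm M \<rho> D = 0" by (simp add: L2_norm_def)
  next
    assume "L2_norm M \<rho> D = 0"
    then show "\<forall>h. smooth_fun M h \<longrightarrow> L2_inner M \<rho> D (grad M h) = 0"
      using L2.cauchy_schwarz[OF horizontal_L2[OF D] grad_L2] by (force simp: L2_norm_eq)
  qed
  have i: "K_W M \<rho> f = K_S M \<rho> H ip f \<longleftrightarrow> L2_eq M P v"
    unfolding tangents_eq D0 unfolding D_def using L2_eq_iff[OF horizontal_L2[OF P] v(2)] by simp
  have ii: "L2_eq M (- v) (- w) \<longleftrightarrow> L2_eq M w v"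
    by (auto simp: L2_eq_def eq_commute)
  have iii: "w - v \<in> ker_A M \<rho>" if "K_W M \<rho> f = K_S M \<rho> H ip f"
  proof -
    have wv: "w - v \<in> L2_vf M \<rho>" by (intro L2.diff_mem w v)
    have "L2_inner M \<rho> (w - v) (grad M h) = 0" if "smooth_fun M h" for h
      using tangents_eq \<open>K_W M \<rho> f = K_S M \<rho> H ip f\<close> defect[OF that] that
      by (simp add: L2.diff_left w v grad_L2)
    then have "A_op M \<rho> (w - v) = 0"
      unfolding A_op_def fun_eq_iff neg_distr_div_weighted[OF L2_vf_field[OF wv]] by simp
    then show ?thesis using wv by (simp add: ker_A_def)
  qed
  have T: "(K_S M \<rho> H ip f - K_W M \<rho> f) h = L2_inner M \<rho> D (grad M h)" if "smooth_fun M h" for h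
    using that by (simp add: K_S K_W defect)
  note iv = Hdot_minus1_horizontal[OF D T]
  show ?thesis
    using i ii iii iv unfolding D_def w_def P_def v_def by blast
qed

end
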